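(* There exists an $\omega$-model of $\mathsf{SRRT}^2_2$ (together with $\mathsf{RCA}_0$) containing only low sets.
   Context: An $\omega$-model is a structure of second-order arithmetic whose first-order part is the standard natural numbers; it is identified with its second-order part, a collection of subsets of $\mathbb{N}$. It is a model of $\mathsf{RCA}_0$ iff this collection is closed under Turing reducibility and effective join (a Turing ideal). A set $A$ is low if $A'\le_T\emptyset'$. $f:[\mathbb{N}]^2\to\mathbb{N}$ (defined on pairs $x<s$) is 2-bounded if $|f^{-1}(y)|\le2$ for every $y$. It is rainbow-stable if for every $x$ one of the following holds: (a) there is $y\neq x$ with $f(x,s)=f(y,s)$ for all but finitely many $s$; or (b) for all but finitely many $s$ there is no $y\ne x$ with $f(x,s)=f(y,s)$. A set $R$ is a rainbow for $f$ if $f$ is injective on $[R]^2$. $\mathsf{SRRT}^2_2$ is the statement "every rainbow-stable 2-bounded coloring $f:[\mathbb{N}]^2\to\mathbb{N}$ has an infinite rainbow". *)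

theory Defs
  imports "HOL-Library.Nat_Bijection" "HOL-Library.Infinite_Set"
begin

text \<open>
  Relative computability.  Programs denote unary partial functions on the natural numbers;
  several arguments are passed as one via the Cantor pairing \<^const>\<open>prod_encode\<close>.  The basic
  functions and operations are those of Kleene's partial recursive functions together with
  \<open>Query\<close>, the characteristic function of the set the computation is relative to.
\<close>

datatype prog =
    Zero
  | Succ
  | Left
  | Right
  | Query
  | Pairing prog prog
  | Comp prog prog
  | Prec prog prog
  | Mu prog

text \<open>
  \<open>eval A p n = Some m\<close> means that \<open>p\<close> relative to \<open>A\<close> halts on input \<open>n\<close> with output \<open>m\<close>, and
  \<open>eval A p n = None\<close> that it diverges.  For \<open>Mu\<close>, all values below the
  zero found have to be defined.
\<close>

primrec eval :: "nat set \<Rightarrow> prog \<Rightarrow> nat \<Rightarrow> nat option" where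
  "eval A Zero = (\<lambda>n. Some 0)"
| "eval A Succ = (\<lambda>n. Some (Suc n))"
| "eval A Left = (\<lambda>n. Some (fst (prod_decode n)))"
| "eval A Right = (\<lambda>n. Some (snd (prod_decode n)))"
| "eval A Query = (\<lambda>n. Some (if n \<in> A then 1 else 0))"
| "eval A (Pairing p q) = (\<lambda>n. case (eval A p n, eval A q n) of
      (Some a, Some b) \<Rightarrow> Some (prod_encode (a, b))
    | _ \<Rightarrow> None)"
| "eval A (Comp p q) = (\<lambda>n. Option.bind (eval A q n) (eval A p))"
| "eval A (Prec p q) = (\<lambda>n. case prod_decode n of (a, k) \<Rightarrow>
      rec_nat (eval A p a)
        (\<lambda>i r. Option.bind r (\<lambda>v. eval A q (prod_encode (a, prod_encode (i, v))))) k)"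
| "eval A (Mu p) = (\<lambda>n.
      if \<exists>m. eval A p (prod_encode (n, m)) = Some 0 \<and>
             (\<forall>k<m. eval A p (prod_encode (n, k)) \<noteq> None)
      then Some (LEAST m. eval A p (prod_encode (n, m)) = Some 0)
      else None)"

definition turing_le :: "nat set \<Rightarrow> nat set \<Rightarrow> bool" (infix "\<le>\<^sub>T" 50) where
  "A \<le>\<^sub>T B \<longleftrightarrow> (\<exists>p. \<forall>n. eval B p n = Some (if n \<in> A then 1 else 0))"

text \<open>An effective numbering of all programs, bijective by \<open>bij_prog_num\<close> below.\<close>

primrec prog_num :: "prog \<Rightarrow> nat" where
  "prog_num Zero = 0"
| "prog_num Succ = 1"
| "prog_num Left = 2"
| "prog_num Right = 3"
| "prog_num Query = 4"
| "prog_num (Pairing p q) = 5 + 4 * prod_encode (prog_num p, prog_num q)"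
| "prog_num (Comp p q) = 6 + 4 * prod_encode (prog_num p, prog_num q)"
| "prog_num (Prec p q) = 7 + 4 * prod_encode (prog_num p, prog_num q)"
| "prog_num (Mu p) = 8 + 4 * prog_num p"

lemma inj_prog_num: "prog_num p = prog_num q \<Longrightarrow> p = q"
proof (induction p arbitrary: q)
  case Zero then show ?case by (cases q) auto
next
  case Succ then show ?case by (cases q) auto
next
  case Left then show ?case by (cases q) auto
next
  case Right then show ?case by (cases q) auto
next
  case Query then show ?case by (cases q) auto
next
  case (Pairing a b)
  from Pairing.prems show ?case by (cases q) (auto dest: Pairing.IH, presburger+)
next
  case (Comp a b)
  from Comp.prems show ?case by (cases q) (auto dest: Comp.IH, presburger+)
next
  case (Prec a b)
  from Prec.prems show ?case by (cases q) (auto dest: Prec.IH, presburger+)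
next
  case (Mu a)
  from Mu.prems show ?case by (cases q) (auto dest: Mu.IH, presburger+)
qed

lemma surj_prog_num: "\<exists>p. prog_num p = n"
proof (induction n rule: less_induct)
  case (less n)
  show ?case
  proof (cases "n < 5")
    case True
    then have "n = 0 \<or> n = 1 \<or> n = 2 \<or> n = 3 \<or> n = 4" by auto
    then show ?thesis
      using prog_num.simps(1-5) by metis
  next
    case False
    define k where "k = (n - 5) div 4"
    obtain a b where ab: "k = prod_encode (a, b)"
      by (metis prod_decode_inverse surj_pair)
    have kn: "k < n" using False by (simp add: k_def)
    have "a < n" "b < n"
      using le_prod_encode_1[of a b] le_prod_encode_2[of b a] kn unfolding ab by linarith+
    with less kn obtain p q r where
      "prog_num p = a" "prog_num q = b" "prog_num r = k" by meson
    moreover have "n = 5 + 4 * k \<or> n = 6 + 4 * k \<or> n = 7 + 4 * k \<or> n = 8 + 4 * k"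
      using False unfolding k_def by presburger
    ultimately show ?thesis
      using ab prog_num.simps(6-9) by metis
  qed
qed

lemma bij_prog_num: "bij prog_num"
  using inj_prog_num surj_prog_num by (metis bijI injI surjI surj_def)

definition jump :: "nat set \<Rightarrow> nat set" where
  "jump A = {e. \<exists>p. prog_num p = e \<and> eval A p e \<noteq> None}"

definition low :: "nat set \<Rightarrow> bool" where
  "low A \<longleftrightarrow> jump A \<le>\<^sub>T jump {}"

definition join :: "nat set \<Rightarrow> nat set \<Rightarrow> nat set" where
  "join A B = {2 * n | n. n \<in> A} \<union> {2 * n + 1 | n. n \<in> B}"

text \<open>
  An \<open>\<omega>\<close>-model is identified with its second-order part, a collection of sets of natural numbers.
  The \<open>\<omega>\<close>-models of \<open>RCA\<^sub>0\<close> are the Turing ideals; these are nonempty, since \<open>RCA\<^sub>0\<close> proves the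
  existence of sets.
\<close>

definition turing_ideal :: "nat set set \<Rightarrow> bool" where
  "turing_ideal M \<longleftrightarrow> M \<noteq> {} \<and>
     (\<forall>A B. B \<in> M \<and> A \<le>\<^sub>T B \<longrightarrow> A \<in> M) \<and>
     (\<forall>A B. A \<in> M \<and> B \<in> M \<longrightarrow> join A B \<in> M)"

text \<open>
  A coloring of pairs is a function \<open>f\<close> of which only the values \<open>f x s\<close> with \<open>x < s\<close> matter.
\<close>

definition pairs :: "nat set \<Rightarrow> (nat \<times> nat) set" where
  "pairs R = {(x, s). x \<in> R \<and> s \<in> R \<and> x < s}"

definition two_bounded :: "(nat \<Rightarrow> nat \<Rightarrow> nat) \<Rightarrow> bool" where
  "two_bounded f \<longleftrightarrow>
     (\<forall>y. finite {(x, s) \<in> pairs UNIV. f x s = y} \<and>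
          card {(x, s) \<in> pairs UNIV. f x s = y} \<le> 2)"

definition rainbow_stable :: "(nat \<Rightarrow> nat \<Rightarrow> nat) \<Rightarrow> bool" where
  "rainbow_stable f \<longleftrightarrow>
     (\<forall>x. (\<exists>y. y \<noteq> x \<and> (\<forall>\<^sub>\<infinity>s. x < s \<and> y < s \<and> f x s = f y s)) \<or>
          (\<forall>\<^sub>\<infinity>s. x < s \<and> \<not> (\<exists>y. y \<noteq> x \<and> y < s \<and> f x s = f y s)))"

definition rainbow :: "(nat \<Rightarrow> nat \<Rightarrow> nat) \<Rightarrow> nat set \<Rightarrow> bool" where
  "rainbow f R \<longleftrightarrow> inj_on (\<lambda>(x, s). f x s) (pairs R)"

text \<open>The set by which a coloring is represented in an \<open>\<omega>\<close>-model.\<close>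

definition coloring_graph :: "(nat \<Rightarrow> nat \<Rightarrow> nat) \<Rightarrow> nat set" where
  "coloring_graph f = {prod_encode (prod_encode (x, s), f x s) | x s. x < s}"

text \<open>
  Truth of \<open>SRRT\<^sup>2\<^sub>2\<close> in the \<open>\<omega>\<close>-model \<open>M\<close>: set quantifiers range over \<open>M\<close>, while the properties
  of \<open>f\<close> and \<open>R\<close> involved quantify over numbers only and hence are evaluated as they stand.
\<close>

definition satisfies_SRRT22 :: "nat set set \<Rightarrow> bool" where
  "satisfies_SRRT22 M \<longleftrightarrow>
     (\<forall>f. coloring_graph f \<in> M \<and> two_bounded f \<and> rainbow_stable f \<longrightarrow>
          (\<exists>R \<in> M. infinite R \<and> rainbow f R))"

end

(* A rainbow is built as an increasing union of finite rainbows, computably in the jump of the low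
   set Z, by forcing with bushy trees.  Every element of a finite rainbow has at most one limit
   partner, so among the children of a node of a tree that branches more often than the node has
   elements there is one that avoids all partners and hence can be extended further.  To decide
   whether e lies in the jump of the set under construction, ask whether the strings that make the
   e-th program halt form a big set above the current one.  This is Sigma_1 in Z, in contrast
   to the question that would mention partners.  If the answer is yes, some such string avoids both
   the partners and the strings forbidden so far; if it is no, these strings are added to the
   forbidden ones, whose union stays small because smallness is additive.  Iterating along a chain
   of low sets yields the model. *)

theory Submission imports Defs
begin

section \<open>Closure properties of relative computability\<close>

text \<open>For a finite rainbow, to be extendible means to contain no two limit partners, a Sigma_2
  condition in Z. Asking for an extendible extension that makes a program halt is therefore too hard
  for the jump. Extendibility enters only with an explicit witness, a bound from which on all
  one-point extensions are rainbows, and checking a witness is Pi_1 in Z. So every condition on a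
  proposed next state is decidable from the jump, and the next state is found by blind search; the
  combinatorics only shows that the search ends. For threshold k, a node with code \<sigma> has to
  branch k * (\<sigma> + 1) times. The set coded by \<sigma> has at most \<sigma> elements, hence at
  most \<sigma> partners, so one extra unit of threshold pays for the partners. A negative answer
  combines the thresholds k and k + 1 into 2 * k + 1. Lowness is shown for the join of Z with the
  rainbow, as the iteration requires. Low sets are computable from the jump of the empty set, so the
  programs with that oracle list all colorings that have to be treated.\<close>

definition computable :: "nat set \<Rightarrow> (nat \<Rightarrow> nat) \<Rightarrow> bool" where
  "computable A f \<longleftrightarrow> (\<exists>p. \<forall>n. eval A p n = Some (f n))"

definition decidable :: "nat set \<Rightarrow> (nat \<Rightarrow> bool) \<Rightarrow> bool" where
  "decidable A P \<longleftrightarrow> computable A (\<lambda>n. if P n then 1 else 0)"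

definition ce :: "nat set \<Rightarrow> (nat \<Rightarrow> bool) \<Rightarrow> bool" where
  "ce A P \<longleftrightarrow> (\<exists>Q. decidable A Q \<and> (\<forall>n. P n \<longleftrightarrow> (\<exists>m. Q (prod_encode (n, m)))))"

abbreviation p1 :: "nat \<Rightarrow> nat" where "p1 n \<equiv> fst (prod_decode n)"
abbreviation p2 :: "nat \<Rightarrow> nat" where "p2 n \<equiv> snd (prod_decode n)"

lemma turing_le_iff_decidable: "A \<le>\<^sub>T B \<longleftrightarrow> decidable B (\<lambda>n. n \<in> A)"
  by (simp add: turing_le_def decidable_def computable_def)

lemma computable_compose:
  assumes "computable A f" "computable A g"
  shows "computable A (\<lambda>x. f (g x))"
proof -
  obtain p q where "\<forall>n. eval A p n = Some (f n)" "\<forall>n. eval A q n = Some (g n)"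
    using assms unfolding computable_def by auto
  then have "\<forall>n. eval A (Comp p q) n = Some (f (g n))" by simp
  then show ?thesis unfolding computable_def by blast
qed

lemma computable_id: "computable A (\<lambda>x. x)"
  unfolding computable_def by (rule exI[of _ "Pairing Left Right"]) simp

lemma computable_Suc: "computable A f \<Longrightarrow> computable A (\<lambda>x. Suc (f x))"
  by (rule computable_compose[of A Suc]) (auto simp: computable_def intro: exI[of _ Succ])

lemma computable_const: "computable A (\<lambda>x. c)"
proof (induction c)
  case 0
  show ?case unfolding computable_def by (rule exI[of _ Zero]) simp
qed (rule computable_Suc)

lemma computable_fst: "computable A f \<Longrightarrow> computable A (\<lambda>x. p1 (f x))"
  by (rule computable_compose[of A p1]) (auto simp: computable_def intro: exI[of _ Left])

lemma computable_snd: "computable A f \<Longrightarrow> computable A (\<lambda>x. p2 (f x))"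
  by (rule computable_compose[of A p2]) (auto simp: computable_def intro: exI[of _ Right])

lemma computable_pair:
  assumes "computable A f" "computable A g"
  shows "computable A (\<lambda>x. prod_encode (f x, g x))"
proof -
  obtain p q where "\<forall>n. eval A p n = Some (f n)" "\<forall>n. eval A q n = Some (g n)"
    using assms unfolding computable_def by auto
  then have "\<forall>n. eval A (Pairing p q) n = Some (prod_encode (f n, g n))" by simp
  then show ?thesis unfolding computable_def by blast
qed

text \<open>The argument \<open>z\<close> packs the parameter \<open>x\<close>, the counter and the
  previous value exactly as \<open>Prec\<close> passes them to its step program. Feeding
  \<open>Prec\<close> the pair of \<open>x\<close> and \<open>k x\<close> lets base, step and length
  all depend on the same \<open>x\<close>.\<close>

lemma computable_rec:
  assumes "computable A g" "computable A (\<lambda>z. h (p1 z) (p1 (p2 z)) (p2 (p2 z)))" "computable A k"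
  shows "computable A (\<lambda>x. rec_nat (g x) (h x) (k x))"
proof -
  obtain p q where p: "\<And>n. eval A p n = Some (g n)"
    and q: "\<And>n. eval A q n = Some (h (p1 n) (p1 (p2 n)) (p2 (p2 n)))"
    using assms unfolding computable_def by metis
  have "rec_nat (eval A p a) (\<lambda>i r. Option.bind r
      (\<lambda>v. eval A q (prod_encode (a, prod_encode (i, v))))) m = Some (rec_nat (g a) (h a) m)" for a m
    by (induction m) (simp_all add: p q)
  then have "eval A (Prec p q) n = Some (rec_nat (g (p1 n)) (h (p1 n)) (p2 n))" for n
    by (simp add: case_prod_beta)
  then have "computable A (\<lambda>n. rec_nat (g (p1 n)) (h (p1 n)) (p2 n))"
    unfolding computable_def by blast
  from computable_compose[OF this computable_pair[OF computable_id assms(3)]]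
  show ?thesis by simp
qed

lemma decidable_oracle: "computable A f \<Longrightarrow> decidable A (\<lambda>x. f x \<in> A)"
  unfolding decidable_def
  by (rule computable_compose[of A "\<lambda>n. if n \<in> A then 1 else 0"])
    (auto simp: computable_def intro: exI[of _ Query])

lemma computable_add:
  assumes "computable A f" "computable A g"
  shows "computable A (\<lambda>x. f x + g x)"
proof -
  have "rec_nat a (\<lambda>i r. Suc r) b = a + b" for a b :: nat
    by (induction b) auto
  moreover have "computable A (\<lambda>x. rec_nat (f x) (\<lambda>i r. Suc r) (g x))"
    by (intro computable_rec computable_Suc computable_snd computable_id assms)
  ultimately show ?thesis by simp
qed

lemma computable_mult:
  assumes "computable A f" "computable A g"
  shows "computable A (\<lambda>x. f x * g x)"
proof -
  have "rec_nat 0 (\<lambda>i r. r + a) b = a * b" for a b :: nat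
    by (induction b) auto
  moreover have "computable A (\<lambda>x. rec_nat 0 (\<lambda>i r. r + f x) (g x))"
    by (intro computable_rec computable_add computable_snd computable_id computable_const assms
        computable_compose[OF assms(1)] computable_fst)
  ultimately show ?thesis by simp
qed

lemma computable_power:
  assumes "computable A f" "computable A g"
  shows "computable A (\<lambda>x. f x ^ g x)"
proof -
  have "rec_nat 1 (\<lambda>i r. r * a) b = a ^ b" for a b :: nat
    by (induction b) auto
  moreover have "computable A (\<lambda>x. rec_nat 1 (\<lambda>i r. r * f x) (g x))"
    by (intro computable_rec computable_mult computable_snd computable_id computable_const assms
        computable_compose[OF assms(1)] computable_fst)
  ultimately show ?thesis by simp
qed

lemma computable_diff:
  assumes "computable A f" "computable A g"
  shows "computable A (\<lambda>x. f x - g x)"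
proof -
  have pred: "rec_nat 0 (\<lambda>i r. i) b = b - 1" for b :: nat
    by (induction b) auto
  have "computable A (\<lambda>x. rec_nat 0 (\<lambda>i r. i) x)"
    by (intro computable_rec computable_snd computable_fst computable_id computable_const)
  then have *: "computable A (\<lambda>x. x - 1)" by (simp add: pred)
  have "rec_nat a (\<lambda>i r. r - 1) b = a - b" for a b :: nat
    by (induction b) auto
  moreover have "computable A (\<lambda>x. rec_nat (f x) (\<lambda>i r. r - 1) (g x))"
    by (intro computable_rec computable_compose[OF *] computable_snd computable_id assms)
  ultimately show ?thesis by simp
qed

lemma computable_if:
  assumes "decidable A P" "computable A f" "computable A g"
  shows "computable A (\<lambda>x. if P x then f x else g x)"
proof -
  \<comment> \<open>A case distinction is a recursion of length 0 or 1 whose step ignores the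
    previous value.\<close>
  have "computable A (\<lambda>x. rec_nat (g x) (\<lambda>i r. f x) (if P x then 1 else 0))"
    using assms(1) unfolding decidable_def
    by (intro computable_rec computable_compose[OF assms(2)] computable_fst computable_id assms(3))
  also have "(\<lambda>x. rec_nat (g x) (\<lambda>i r. f x) (if P x then 1 else 0)) = (\<lambda>x. if P x then f x else g x)"
    by auto
  finally show ?thesis .
qed

lemma decidable_compose:
  "decidable A P \<Longrightarrow> computable A g \<Longrightarrow> decidable A (\<lambda>x. P (g x))"
  unfolding decidable_def by (rule computable_compose)

lemma decidable_eq0:
  assumes "computable A f"
  shows "decidable A (\<lambda>x. f x = 0)"
proof -
  have "computable A (\<lambda>x. 1 - f x)"
    by (intro computable_diff computable_const assms)
  also have "(\<lambda>x. 1 - f x) = (\<lambda>x. if f x = 0 then 1 else 0)" by auto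
  finally show ?thesis unfolding decidable_def .
qed

lemma decidable_not: "decidable A P \<Longrightarrow> decidable A (\<lambda>x. \<not> P x)"
proof -
  assume "decidable A P"
  then have "decidable A (\<lambda>x. (if P x then 1 else 0 :: nat) = 0)"
    unfolding decidable_def[of A P] by (rule decidable_eq0)
  also have "(\<lambda>x. (if P x then 1 else 0 :: nat) = 0) = (\<lambda>x. \<not> P x)" by auto
  finally show ?thesis .
qed

lemma decidable_conj:
  assumes "decidable A P" "decidable A Q"
  shows "decidable A (\<lambda>x. P x \<and> Q x)"
proof -
  have "computable A (\<lambda>x. if P x then if Q x then 1 else 0 else 0)"
    by (intro computable_if assms(1) assms(2)[unfolded decidable_def] computable_const)
  also have "(\<lambda>x. if P x then if Q x then 1 else 0 else 0) = (\<lambda>x. if P x \<and> Q x then 1 else 0 :: nat)"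
    by auto
  finally show ?thesis unfolding decidable_def .
qed

lemma decidable_disj:
  assumes "decidable A P" "decidable A Q"
  shows "decidable A (\<lambda>x. P x \<or> Q x)"
  using decidable_not[OF decidable_conj[OF decidable_not[OF assms(1)] decidable_not[OF assms(2)]]]
  by simp

lemma decidable_imp:
  assumes "decidable A P" "decidable A Q"
  shows "decidable A (\<lambda>x. P x \<longrightarrow> Q x)"
  using decidable_disj[OF decidable_not[OF assms(1)] assms(2)] by simp

lemma decidable_le:
  assumes "computable A f" "computable A g"
  shows "decidable A (\<lambda>x. f x \<le> g x)"
  using decidable_eq0[OF computable_diff[OF assms]] by simp

lemma decidable_less:
  assumes "computable A f" "computable A g"
  shows "decidable A (\<lambda>x. f x < g x)"
  using decidable_not[OF decidable_le[OF assms(2,1)]] by (simp add: not_le)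

lemma decidable_eq:
  assumes "computable A f" "computable A g"
  shows "decidable A (\<lambda>x. f x = g x)"
  using decidable_conj[OF decidable_le[OF assms] decidable_le[OF assms(2,1)]]
  by (simp add: eq_iff)

lemma decidable_bex:
  assumes "decidable A (\<lambda>z. P (p1 z) (p2 z))" "computable A k"
  shows "decidable A (\<lambda>x. \<exists>i<k x. P x i)"
proof -
  \<comment> \<open>Inside the recursion the parameter and counter sit at \<open>p1 z\<close> and
    \<open>p1 (p2 z)\<close>, so \<open>P\<close> is moved to these positions.\<close>
  have P: "decidable A (\<lambda>z. P (p1 z) (p1 (p2 z)))"
    using decidable_compose[OF assms(1) computable_pair[OF computable_fst computable_fst[OF computable_snd],
          OF computable_id computable_id]] by simp
  have "rec_nat 0 (\<lambda>i r. if P x i then 1 else r) m = (if \<exists>i<m. P x i then 1 else 0 :: nat)" for x m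
    by (induction m) (auto simp: less_Suc_eq)
  moreover have "computable A (\<lambda>x. rec_nat 0 (\<lambda>i r. if P x i then 1 else r) (k x))"
    by (intro computable_rec computable_if P computable_snd computable_id computable_const assms)
  ultimately show ?thesis by (simp add: decidable_def)
qed

lemma decidable_ball:
  assumes "decidable A (\<lambda>z. P (p1 z) (p2 z))" "computable A k"
  shows "decidable A (\<lambda>x. \<forall>i<k x. P x i)"
  using decidable_not[OF decidable_bex[OF decidable_not[OF assms(1)] assms(2)]] by simp

lemma computable_sum:
  assumes "computable A (\<lambda>z. f (p1 z) (p2 z))" "computable A k"
  shows "computable A (\<lambda>x. \<Sum>i<k x. f x i)"
proof -
  have f: "computable A (\<lambda>z. f (p1 z) (p1 (p2 z)))"
    using computable_compose[OF assms(1) computable_pair[OF computable_fst computable_fst[OF computable_snd],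
          OF computable_id computable_id]] by simp
  have "rec_nat 0 (\<lambda>i r. r + f x i) m = (\<Sum>i<m. f x i)" for x m
    by (induction m) auto
  moreover have "computable A (\<lambda>x. rec_nat 0 (\<lambda>i r. r + f x i) (k x))"
    by (intro computable_rec computable_add f computable_snd computable_id computable_const assms)
  ultimately show ?thesis by simp
qed

lemma computable_card:
  assumes "decidable A (\<lambda>z. P (p1 z) (p2 z))" "computable A k"
  shows "computable A (\<lambda>x. card {i. i < k x \<and> P x i})"
proof -
  have "card {i. i < m \<and> P x i} = (\<Sum>i<m. if P x i then 1 else 0)" for x m
    by (simp add: sum.If_cases lessThan_def Collect_conj_eq)
  then show ?thesis
    using computable_sum[of A "\<lambda>x i. if P x i then 1 else 0" k] assms by (simp add: decidable_def)
qed

lemma computable_set_encode: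
  assumes "decidable A (\<lambda>z. P (p1 z) (p2 z))" "computable A k"
  shows "computable A (\<lambda>x. set_encode {i. i < k x \<and> P x i})"
proof -
  have "set_encode {i. i < m \<and> P x i} = (\<Sum>i<m. if P x i then 2 ^ i else 0)" for x m
    by (simp add: sum.If_cases lessThan_def Collect_conj_eq set_encode_def)
  moreover have "computable A (\<lambda>x. \<Sum>i<k x. if P x i then 2 ^ i else 0)"
    by (intro computable_sum computable_if computable_power computable_snd computable_id
        computable_const assms)
  ultimately show ?thesis by simp
qed

lemma computable_Least:
  assumes "decidable A (\<lambda>z. P (p1 z) (p2 z))" "\<And>x. \<exists>m. P x m"
  shows "computable A (\<lambda>x. LEAST m. P x m)"
proof -
  \<comment> \<open>\<open>Mu\<close> searches for a zero, hence the characteristic function of the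
    negation.\<close>
  obtain p where p: "\<And>n. eval A p n = Some (if \<not> P (p1 n) (p2 n) then 1 else 0)"
    using decidable_not[OF assms(1)] unfolding decidable_def computable_def by metis
  have "eval A (Mu p) n = Some (LEAST m. P n m)" for n
    using assms(2)[of n] by (simp add: p)
  then show ?thesis unfolding computable_def by blast
qed

lemmas computability =
  computable_id computable_const computable_Suc computable_fst computable_snd computable_pair
  computable_add computable_mult computable_power computable_diff computable_if computable_card
  computable_set_encode decidable_not decidable_conj decidable_disj decidable_imp
  decidable_le decidable_less decidable_eq decidable_bex decidable_ball

text \<open>Membership is a bit test, \<open>odd (n div d)\<close> with \<open>d\<close> a power of
  two. Division with remainder turns it into bounded quantifiers over sums, products and powers, to
  which the closure rules apply.\<close>

lemma decidable_set_decode: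
  assumes "computable A f" "computable A g"
  shows "decidable A (\<lambda>x. f x \<in> set_decode (g x))"
proof -
  have "odd (n div d) \<longleftrightarrow> (\<exists>q<Suc n. \<exists>r<d. n = d * (2 * q + 1) + r)" if "d > 0" for n d :: nat
  proof
    assume "odd (n div d)"
    then obtain q where q: "n div d = 2 * q + 1" by (rule oddE)
    have "n = d * (n div d) + n mod d" by simp
    moreover have "q \<le> n" using q div_le_dividend[of n d] by linarith
    ultimately show "\<exists>q<Suc n. \<exists>r<d. n = d * (2 * q + 1) + r"
      using q that by (intro exI[of _ q] exI[of _ "n mod d"] conjI) (auto simp flip: q)
  next
    assume "\<exists>q<Suc n. \<exists>r<d. n = d * (2 * q + 1) + r"
    then obtain q r where "n = r + d * (2 * q + 1)" "r < d" by (auto simp: ac_simps)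
    then have "n div d = 2 * q + 1"
      using that div_mult_self2[of d r "2 * q + 1"] by simp
    then show "odd (n div d)" by simp
  qed
  from this[of "2 ^ p2 z" "p1 z" for z]
  have "(\<lambda>z. p2 z \<in> set_decode (p1 z)) =
     (\<lambda>z. \<exists>q<Suc (p1 z). \<exists>r<2 ^ p2 z. p1 z = 2 ^ p2 z * (2 * q + 1) + r)"
    by (simp add: set_decode_def)
  moreover have "decidable A \<dots>" by (intro computability)
  ultimately have "decidable A (\<lambda>z. p2 z \<in> set_decode (p1 z))" by simp
  from decidable_compose[OF this computable_pair[OF assms(2,1)]] show ?thesis by simp
qed

lemma decidable_compose2:
  assumes "decidable A (\<lambda>z. P (p1 z) (p2 z))" "computable A f" "computable A g"
  shows "decidable A (\<lambda>x. P (f x) (g x))"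
  using decidable_compose[OF assms(1) computable_pair[OF assms(2,3)]] by simp

lemma computable_compose2:
  assumes "computable A (\<lambda>z. h (p1 z) (p2 z))" "computable A f" "computable A g"
  shows "computable A (\<lambda>x. h (f x) (g x))"
  using computable_compose[OF assms(1) computable_pair[OF assms(2,3)]] by simp

lemma decidable_compose3:
  assumes "decidable A (\<lambda>z. P (p1 z) (p1 (p2 z)) (p2 (p2 z)))"
    "computable A f" "computable A g" "computable A h"
  shows "decidable A (\<lambda>x. P (f x) (g x) (h x))"
  using decidable_compose[OF assms(1) computable_pair[OF assms(2) computable_pair[OF assms(3,4)]]]
  by simp

section \<open>Substitution of oracles and transitivity of Turing reducibility\<close>

primrec oracle_subst :: "prog \<Rightarrow> prog \<Rightarrow> prog" where
  "oracle_subst r Zero = Zero"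
| "oracle_subst r Succ = Succ"
| "oracle_subst r Left = Left"
| "oracle_subst r Right = Right"
| "oracle_subst r Query = r"
| "oracle_subst r (Pairing p q) = Pairing (oracle_subst r p) (oracle_subst r q)"
| "oracle_subst r (Comp p q) = Comp (oracle_subst r p) (oracle_subst r q)"
| "oracle_subst r (Prec p q) = Prec (oracle_subst r p) (oracle_subst r q)"
| "oracle_subst r (Mu p) = Mu (oracle_subst r p)"

lemma eval_oracle_subst:
  assumes "\<And>n. eval A r n = Some (if n \<in> B then 1 else 0)"
  shows "eval A (oracle_subst r p) = eval B p"
proof (induction p)
  case (Mu p)
  show ?case unfolding oracle_subst.simps eval.simps Mu.IH ..
qed (simp_all add: assms)

lemma computable_trans: "A \<le>\<^sub>T B \<Longrightarrow> computable A f \<Longrightarrow> computable B f"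
  unfolding computable_def turing_le_def using eval_oracle_subst by metis

lemma decidable_trans: "A \<le>\<^sub>T B \<Longrightarrow> decidable A P \<Longrightarrow> decidable B P"
  unfolding decidable_def by (rule computable_trans)

lemma ce_trans: "A \<le>\<^sub>T B \<Longrightarrow> ce A P \<Longrightarrow> ce B P"
  unfolding ce_def using decidable_trans by blast

lemma turing_le_refl: "A \<le>\<^sub>T A"
  unfolding turing_le_iff_decidable by (intro decidable_oracle computable_id)

lemma turing_le_trans: "A \<le>\<^sub>T B \<Longrightarrow> B \<le>\<^sub>T C \<Longrightarrow> A \<le>\<^sub>T C"
  unfolding turing_le_iff_decidable[of A] by (rule decidable_trans)

section \<open>Computably enumerable predicates and the jump\<close>

lemma ceI:
  assumes "decidable A (\<lambda>z. Q (p1 z) (p2 z))" "\<And>n. P n \<longleftrightarrow> (\<exists>m. Q n m)"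
  shows "ce A P"
  unfolding ce_def using assms by (intro exI[of _ "\<lambda>z. Q (p1 z) (p2 z)"]) simp

lemma ceE:
  assumes "ce A P"
  obtains Q where "decidable A (\<lambda>z. Q (p1 z) (p2 z))" "\<And>n. P n \<longleftrightarrow> (\<exists>m. Q n m)"
proof -
  obtain Q where Q: "decidable A Q" "\<And>n. P n \<longleftrightarrow> (\<exists>m. Q (prod_encode (n, m)))"
    using assms unfolding ce_def by blast
  then show thesis by (intro that[of "\<lambda>n m. Q (prod_encode (n, m))"]) simp_all
qed

lemma ce_decidable: "decidable A P \<Longrightarrow> ce A P"
 
  by (rule ceI[of _ "\<lambda>n m. P n"]) (simp_all add: decidable_compose[of A P] computable_fst computable_id)

lemma ce_compose:
  assumes "ce A P" "computable A f"
  shows "ce A (\<lambda>x. P (f x))"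
proof -
  obtain Q where Q: "decidable A (\<lambda>z. Q (p1 z) (p2 z))" "\<And>n. P n \<longleftrightarrow> (\<exists>m. Q n m)"
    using assms(1) by (elim ceE) blast
  show ?thesis
    by (rule ceI[of _ "\<lambda>x. Q (f x)"])
      (intro decidable_compose2[OF Q(1)] computable_compose[OF assms(2)] computability, rule Q(2))
qed

lemma ce_ex:
  assumes "ce A (\<lambda>z. P (p1 z) (p2 z))"
  shows "ce A (\<lambda>x. \<exists>y. P x y)"
proof -
  obtain Q where Q: "decidable A (\<lambda>z. Q (p1 z) (p2 z))" "\<And>n. P (p1 n) (p2 n) \<longleftrightarrow> (\<exists>m. Q n m)"
    using assms by (elim ceE) blast
  have "(\<exists>y. P x y) \<longleftrightarrow> (\<exists>w. Q (prod_encode (x, p1 w)) (p2 w))" for x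
    using Q(2)[of "prod_encode (x, y)" for y] by (metis fst_conv prod_encode_inverse snd_conv)
  then show ?thesis
    by (intro ceI[of _ "\<lambda>x w. Q (prod_encode (x, p1 w)) (p2 w)"] decidable_compose2[OF Q(1)] computability)
qed

lemma ce_conj:
  assumes "ce A P" "ce A P'"
  shows "ce A (\<lambda>x. P x \<and> P' x)"
proof -
  obtain Q where Q: "decidable A (\<lambda>z. Q (p1 z) (p2 z))" "\<And>n. P n \<longleftrightarrow> (\<exists>m. Q n m)"
    using assms(1) by (elim ceE) blast
  obtain Q' where Q': "decidable A (\<lambda>z. Q' (p1 z) (p2 z))" "\<And>n. P' n \<longleftrightarrow> (\<exists>m. Q' n m)"
    using assms(2) by (elim ceE) blast
  have "P x \<and> P' x \<longleftrightarrow> (\<exists>w. Q x (p1 w) \<and> Q' x (p2 w))" for x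
    unfolding Q Q' by (metis fst_conv prod_encode_inverse snd_conv)
  then show ?thesis
    by (intro ceI[of _ "\<lambda>x w. Q x (p1 w) \<and> Q' x (p2 w)"] decidable_compose2[OF Q(1)]
        decidable_compose2[OF Q'(1)] computability)
qed

text \<open>Hard-wires an input: \<open>Comp p (const_prog n)\<close> runs \<open>p\<close> on
  \<open>n\<close> whatever its own input is. Since its number is computable from \<open>n\<close>,
  this plays the part of the s-m-n theorem in \<open>decidable_jump\<close>.\<close>

primrec const_prog :: "nat \<Rightarrow> prog" where
  "const_prog 0 = Zero"
| "const_prog (Suc n) = Comp Succ (const_prog n)"

lemma eval_const_prog: "eval A (const_prog n) x = Some n"
  by (induction n) simp_all

lemma computable_prog_num_const_prog: "computable A (\<lambda>n. prog_num (const_prog n))"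
proof -
  have "prog_num (const_prog n) = rec_nat 0 (\<lambda>i r. 6 + 4 * prod_encode (1, r)) n" for n
    by (induction n) simp_all
  moreover have "computable A (\<lambda>n. rec_nat 0 (\<lambda>i r. 6 + 4 * prod_encode (1, r)) n)"
    by (intro computable_rec computability)
  ultimately show ?thesis by simp
qed

text \<open>The program with number \<open>r n\<close> ignores its input and searches for a witness
  of \<open>P n\<close>. That the jump runs it on its own number is therefore harmless, and
  \<open>P n\<close> becomes one query to the jump.\<close>

lemma decidable_jump:
  assumes "ce A P"
  shows "decidable (jump A) P"
proof -
  obtain Q where Q: "decidable A (\<lambda>z. Q (p1 z) (p2 z))" "\<And>n. P n \<longleftrightarrow> (\<exists>m. Q n m)"
    using assms by (elim ceE) blast
  obtain p where p: "\<And>n. eval A p n = Some (if \<not> Q (p1 n) (p2 n) then 1 else 0)"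
    using decidable_not[OF Q(1)] unfolding decidable_def computable_def by metis
  define r where "r n = prog_num (Comp (Mu p) (const_prog n))" for n
  have "r n \<in> jump A \<longleftrightarrow> eval A (Comp (Mu p) (const_prog n)) (r n) \<noteq> None" for n
    unfolding jump_def r_def using inj_prog_num by blast
  then have "P = (\<lambda>n. r n \<in> jump A)"
    by (simp add: fun_eq_iff Q(2) eval_const_prog p)
  moreover have "computable (jump A) r"
    unfolding r_def by (simp del: prog_num.simps(9), intro computability computable_prog_num_const_prog)
  ultimately show ?thesis using decidable_oracle by simp
qed

lemma turing_le_jump: "A \<le>\<^sub>T jump A"
  unfolding turing_le_iff_decidable by (intro decidable_jump ce_decidable decidable_oracle computable_id)

section \<open>Inductive definitions with finitary rules\<close>

text \<open>\<open>\<Phi> t w n\<close> derives \<open>n\<close> from the finite set coded by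
  \<open>w\<close>, with \<open>t\<close> bounding the search for all other witnesses so that \<Phi>
  can be decidable. Both the evaluation of programs and bigness are closures of this kind.\<close>

inductive_set rule_closure :: "(nat \<Rightarrow> nat \<Rightarrow> nat \<Rightarrow> bool) \<Rightarrow> nat set" for \<Phi> where
  rule_closureI: "(\<And>x. x \<in> set_decode w \<Longrightarrow> x \<in> rule_closure \<Phi>) \<Longrightarrow> \<Phi> t w n \<Longrightarrow> n \<in> rule_closure \<Phi>"

text \<open>The set derived at stage \<open>t\<close>, with only numbers below \<open>t\<close> considered, is coded by
  a single number; this makes the stages computable by primitive recursion.\<close>

lemma ce_rule_closure:
  assumes dec: "decidable A (\<lambda>z. \<Phi> (p1 z) (p1 (p2 z)) (p2 (p2 z)))"
    and mono: "\<And>t t' w w' n. \<Phi> t w n \<Longrightarrow> t \<le> t' \<Longrightarrow> set_decode w \<subseteq> set_decode w' \<Longrightarrow> \<Phi> t' w' n"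
  shows "ce A (\<lambda>n. n \<in> rule_closure \<Phi>)"
proof -
  define W where "W t = rec_nat 0
    (\<lambda>i w. set_encode {n. n < i \<and> (n \<in> set_decode w \<or> \<Phi> i w n)}) t" for t
  have W_0: "set_decode (W 0) = {}" by (simp add: W_def)
  have W_Suc: "set_decode (W (Suc t)) =
      {n. n < t \<and> (n \<in> set_decode (W t) \<or> \<Phi> t (W t) n)}" for t
    by (simp add: W_def set_encode_inverse)
  \<comment> \<open>Needed for monotonicity: as stage \<open>t\<close> only has elements below
    \<open>t\<close>, the cut-off in the next stage drops none of them.\<close>
  have bound: "n \<in> set_decode (W t) \<Longrightarrow> n < t" for n t
    by (cases t) (auto simp: W_0 W_Suc)
  have W_mono: "set_decode (W t) \<subseteq> set_decode (W t')" if "t \<le> t'" for t t'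
    using that
  proof (induction rule: dec_induct)
    case (step i)
    then show ?case using bound W_Suc by (auto dest: subsetD)
  qed simp
  have "n \<in> rule_closure \<Phi> \<longleftrightarrow> (\<exists>t. n \<in> set_decode (W t))" for n
  proof
    assume "n \<in> rule_closure \<Phi>"
    then show "\<exists>t. n \<in> set_decode (W t)"
    proof induction
      case (rule_closureI w t n)
      then have "\<forall>x\<in>set_decode w. \<exists>t. x \<in> set_decode (W t)" by blast
      then obtain g where g: "\<And>x. x \<in> set_decode w \<Longrightarrow> x \<in> set_decode (W (g x))"
        by metis
      \<comment> \<open>A stage beyond \<open>n\<close>, beyond \<open>t\<close> and beyond the
        stages of all premises; monotonicity of \<Phi> lets the rule fire there.\<close>
      define s where "s = Max (insert (Suc n) (insert t (g ` set_decode w)))"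
      have s: "Suc n \<le> s" "t \<le> s" "\<And>x. x \<in> set_decode w \<Longrightarrow> g x \<le> s"
        unfolding s_def by (rule Max_ge; simp)+
      have "set_decode w \<subseteq> set_decode (W s)"
        using g s(3) W_mono by blast
      with mono[OF rule_closureI(2) s(2)] s(1) have "n \<in> set_decode (W (Suc s))"
        by (simp add: W_Suc)
      then show ?case ..
    qed
  next
    assume "\<exists>t. n \<in> set_decode (W t)"
    then obtain t where "n \<in> set_decode (W t)" ..
    then show "n \<in> rule_closure \<Phi>"
    proof (induction t arbitrary: n)
      case (Suc t)
      then show ?case
        using rule_closure.intros[of "W t" \<Phi> t n] by (auto simp: W_Suc)
    qed (simp add: W_0)
  qed
  moreover have "computable A (\<lambda>z. W (p2 z))"
    unfolding W_def
    by (intro computable_rec computability decidable_set_decode decidable_compose3[OF dec])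
  ultimately show ?thesis
    by (intro ceI[of _ "\<lambda>n t. n \<in> set_decode (W t)"] decidable_set_decode computability)
qed

section \<open>Computations with partial oracles\<close>

text \<open>Here \<open>Ans q b\<close> means that the query \<open>q\<close> is answered by \<open>b\<close>; the oracle may be partial.\<close>

inductive computes :: "(nat \<Rightarrow> nat \<Rightarrow> bool) \<Rightarrow> prog \<Rightarrow> nat \<Rightarrow> nat \<Rightarrow> bool" for Ans where
  Zero: "computes Ans Zero n 0"
| Succ: "computes Ans Succ n (Suc n)"
| Left: "computes Ans Left n (p1 n)"
| Right: "computes Ans Right n (p2 n)"
| Query: "Ans n b \<Longrightarrow> computes Ans Query n b"
| Pairing: "computes Ans p n a \<Longrightarrow> computes Ans q n b \<Longrightarrow> computes Ans (Pairing p q) n (prod_encode (a, b))"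
| Comp: "computes Ans q n a \<Longrightarrow> computes Ans p a b \<Longrightarrow> computes Ans (Comp p q) n b"
| Prec0: "computes Ans p a v \<Longrightarrow> computes Ans (Prec p q) (prod_encode (a, 0)) v"
| PrecSuc: "computes Ans (Prec p q) (prod_encode (a, k)) v \<Longrightarrow>
    computes Ans q (prod_encode (a, prod_encode (k, v))) u \<Longrightarrow>
    computes Ans (Prec p q) (prod_encode (a, Suc k)) u"
| Mu: "computes Ans p (prod_encode (n, m)) 0 \<Longrightarrow>
    (\<And>k. k < m \<Longrightarrow> \<exists>v. computes Ans p (prod_encode (n, k)) (Suc v)) \<Longrightarrow> computes Ans (Mu p) n m"

abbreviation answers :: "nat set \<Rightarrow> nat \<Rightarrow> nat \<Rightarrow> bool" where
  "answers A q b \<equiv> b = (if q \<in> A then 1 else 0)"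

lemma computes_mono:
  assumes "computes Ans p n m" "\<And>q b. Ans q b \<Longrightarrow> Ans' q b"
  shows "computes Ans' p n m"
  using assms(1)
proof induction
  case (Mu p n m)
  then show ?case by (intro computes.Mu) auto
qed (auto intro: computes.intros assms(2))

lemma computes_sound:
  assumes "computes Ans p n m" "\<And>q b. Ans q b \<Longrightarrow> answers A q b"
  shows "eval A p n = Some m"
  using assms(1)
proof induction
  case (Mu p n m)
  then have *: "\<And>k. k < m \<Longrightarrow> \<exists>v. eval A p (prod_encode (n, k)) = Some (Suc v)" by blast
  have "(LEAST m. eval A p (prod_encode (n, m)) = Some 0) = m"
    using Mu.IH(1) * by (intro Least_equality) (fastforce simp flip: not_less)+
  moreover have "\<forall>k<m. eval A p (prod_encode (n, k)) \<noteq> None" using * by fastforce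
  ultimately show ?case using Mu.IH(1) by auto
qed (use assms(2) in auto)

text \<open>The use principle. A halting computation consists of finitely many subcomputations, and
  the maximum of their bounds serves the whole; for \<open>Mu\<close> these are the test at
  \<open>m\<close> and the failed tests below it.\<close>

lemma computes_use:
  assumes "eval A p n = Some m"
  shows "\<exists>u. computes (\<lambda>q b. q < u \<and> answers A q b) p n m"
  using assms
proof (induction p arbitrary: n m)
  case Zero then show ?case by (auto intro: computes.intros)
next
  case Succ then show ?case by (auto intro: computes.intros)
next
  case Left then show ?case by (auto intro: computes.intros)
next
  case Right then show ?case by (auto intro: computes.intros)
next
  case Query
  have "computes (\<lambda>q b. q < Suc n \<and> answers A q b) Query n m"
    using Query by (intro computes.Query) auto
  then show ?case ..
next
  case (Pairing p q)
  from Pairing.prems obtain a b where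
    ab: "eval A p n = Some a" "eval A q n = Some b" "m = prod_encode (a, b)"
    by (auto split: option.splits)
  obtain u v where u: "computes (\<lambda>q b. q < u \<and> answers A q b) p n a"
    and v: "computes (\<lambda>q b. q < v \<and> answers A q b) q n b"
    using Pairing.IH ab by meson
  have "computes (\<lambda>q b. q < max u v \<and> answers A q b) (Pairing p q) n m"
    unfolding ab(3) by (intro computes.Pairing; rule computes_mono[OF u] computes_mono[OF v]) auto
  then show ?case ..
next
  case (Comp p q)
  from Comp.prems obtain a where ab: "eval A q n = Some a" "eval A p a = Some m"
    by (auto simp: bind_eq_Some_conv)
  obtain u v where u: "computes (\<lambda>q b. q < u \<and> answers A q b) q n a"
    and v: "computes (\<lambda>q b. q < v \<and> answers A q b) p a m"
    using Comp.IH ab by meson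
  have "computes (\<lambda>q b. q < max u v \<and> answers A q b) (Comp p q) n m"
    by (rule computes.Comp[of _ _ _ a]; rule computes_mono[OF u] computes_mono[OF v]) auto
  then show ?case ..
next
  case (Prec p q)
  obtain a k where n: "n = prod_encode (a, k)" by (metis prod_decode_inverse surj_pair)
  define r where "r = rec_nat (eval A p a)
        (\<lambda>i r. Option.bind r (\<lambda>v. eval A q (prod_encode (a, prod_encode (i, v)))))"
  have "\<exists>u. computes (\<lambda>q b. q < u \<and> answers A q b) (Prec p q) (prod_encode (a, k)) m"
    if "r k = Some m" for k m
    using that
  proof (induction k arbitrary: m)
    case 0
    then show ?case using Prec.IH(1) by (fastforce simp: r_def intro: computes.Prec0)
  next
    case (Suc k)
    then obtain v where v: "r k = Some v" "eval A q (prod_encode (a, prod_encode (k, v))) = Some m"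
      by (auto simp: r_def bind_eq_Some_conv)
    obtain u w where u: "computes (\<lambda>q b. q < u \<and> answers A q b) (Prec p q) (prod_encode (a, k)) v"
      and w: "computes (\<lambda>q b. q < w \<and> answers A q b) q (prod_encode (a, prod_encode (k, v))) m"
      using Suc.IH[OF v(1)] Prec.IH(2)[OF v(2)] by blast
    have "computes (\<lambda>q b. q < max u w \<and> answers A q b) (Prec p q) (prod_encode (a, Suc k)) m"
      by (rule computes.PrecSuc[of _ _ _ _ _ v]; rule computes_mono[OF u] computes_mono[OF w]) auto
    then show ?case ..
  qed
  moreover have "r k = Some m" using Prec.prems by (simp add: r_def n)
  ultimately show ?case unfolding n .
next
  case (Mu p)
  let ?P = "\<lambda>m. eval A p (prod_encode (n, m)) = Some 0 \<and> (\<forall>k<m. eval A p (prod_encode (n, k)) \<noteq> None)"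
  from Mu.prems obtain m' where m': "?P m'"
    and m: "m = (LEAST m. eval A p (prod_encode (n, m)) = Some 0)"
    by (auto split: if_splits)
  have "m \<le> m'" unfolding m using m' Least_le[of "\<lambda>m. eval A p (prod_encode (n, m)) = Some 0" m'] by blast
  have z: "eval A p (prod_encode (n, m)) = Some 0"
    unfolding m using m' LeastI[of "\<lambda>m. eval A p (prod_encode (n, m)) = Some 0" m'] by blast
  have "\<exists>v. eval A p (prod_encode (n, k)) = Some (Suc v)" if k: "k < m" for k
  proof -
    obtain v where v: "eval A p (prod_encode (n, k)) = Some v"
      using m' less_le_trans[OF k \<open>m \<le> m'\<close>] by blast
    moreover have "v \<noteq> 0" 
      using v k not_less_Least[of k "\<lambda>m. eval A p (prod_encode (n, m)) = Some 0", folded m] by auto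
    ultimately show ?thesis by (cases v) auto
  qed
  then have "\<forall>k\<in>{..<m}. \<exists>w. computes (\<lambda>q b. q < snd w \<and> answers A q b) p (prod_encode (n, k)) (Suc (fst w))"
    using Mu.IH by fastforce
  from bchoice[OF this] obtain w where w:
    "\<And>k. k < m \<Longrightarrow> computes (\<lambda>q b. q < snd (w k) \<and> answers A q b) p (prod_encode (n, k)) (Suc (fst (w k)))"
    by blast
  obtain u0 where u0: "computes (\<lambda>q b. q < u0 \<and> answers A q b) p (prod_encode (n, m)) 0"
    using Mu.IH[OF z] by blast
  define x where "x = Max (insert u0 ((snd \<circ> w) ` {..<m}))"
  have x: "u0 \<le> x" "\<And>k. k < m \<Longrightarrow> snd (w k) \<le> x"
    unfolding x_def by (rule Max_ge; simp)+
  have "computes (\<lambda>q b. q < x \<and> answers A q b) (Mu p) n m"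
  proof (rule computes.Mu)
    show "computes (\<lambda>q b. q < x \<and> answers A q b) p (prod_encode (n, m)) 0"
      by (rule computes_mono[OF u0]) (use x in auto)
    show "\<exists>v. computes (\<lambda>q b. q < x \<and> answers A q b) p (prod_encode (n, k)) (Suc v)" if "k < m" for k
      by (rule exI, rule computes_mono[OF w[OF that]]) (use x that in fastforce)
  qed
  then show ?case ..
qed

lemma eval_iff_computes: "eval A p n = Some m \<longleftrightarrow> computes (answers A) p n m"
proof
  assume "eval A p n = Some m"
  then obtain u where "computes (\<lambda>q b. q < u \<and> answers A q b) p n m"
    using computes_use by blast
  then show "computes (answers A) p n m" by (rule computes_mono) blast
qed (rule computes_sound)

text \<open>Codes the fact that program number \<open>e\<close>, run with the oracle of index
  \<open>c\<close>, maps \<open>n\<close> to \<open>m\<close>. Carrying the index lets one closure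
  handle a whole family of oracles uniformly.\<close>

definition triple_fact :: "nat \<Rightarrow> nat \<Rightarrow> nat \<Rightarrow> nat \<Rightarrow> nat" where
  "triple_fact c e n m = prod_encode (c, prod_encode (e, prod_encode (n, m)))"

lemma triple_fact_inject [simp]:
  "triple_fact c e n m = triple_fact c' e' n' m' \<longleftrightarrow> c = c' \<and> e = e' \<and> n = n' \<and> m = m'"
  by (auto simp: triple_fact_def)

text \<open>The clauses of \<open>computes\<close> in arithmetical form and in the same order; the
  constants are those of \<open>prog_num\<close>. \<open>t\<close> occurs only as a bound of
  existential quantifiers and \<open>w\<close> only positively, which yields monotonicity.\<close>

definition computes_rule :: "(nat \<Rightarrow> nat \<Rightarrow> nat \<Rightarrow> bool) \<Rightarrow> nat \<Rightarrow> nat \<Rightarrow> nat \<Rightarrow> nat \<Rightarrow> nat \<Rightarrow> nat \<Rightarrow> bool" where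
  "computes_rule Ans t w c e n m \<longleftrightarrow>
     e = 0 \<and> m = 0 \<or> e = 1 \<and> m = Suc n \<or> e = 2 \<and> m = p1 n \<or> e = 3 \<and> m = p2 n \<or> e = 4 \<and> Ans c n m \<or>
     (\<exists>p<t. \<exists>q<t. e = 5 + 4 * prod_encode (p, q) \<and>
        triple_fact c p n (p1 m) \<in> set_decode w \<and> triple_fact c q n (p2 m) \<in> set_decode w) \<or>
     (\<exists>p<t. \<exists>q<t. e = 6 + 4 * prod_encode (p, q) \<and>
        (\<exists>a<t. triple_fact c q n a \<in> set_decode w \<and> triple_fact c p a m \<in> set_decode w)) \<or>
     (\<exists>p<t. \<exists>q<t. e = 7 + 4 * prod_encode (p, q) \<and>
        (p2 n = 0 \<and> triple_fact c p (p1 n) m \<in> set_decode w \<or>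
        (\<exists>k<t. \<exists>v<t. p2 n = Suc k \<and> triple_fact c e (prod_encode (p1 n, k)) v \<in> set_decode w \<and>
           triple_fact c q (prod_encode (p1 n, prod_encode (k, v))) m \<in> set_decode w))) \<or>
     (\<exists>p<t. e = 8 + 4 * p \<and> triple_fact c p (prod_encode (n, m)) 0 \<in> set_decode w \<and>
        (\<forall>k<m. \<exists>v<t. triple_fact c p (prod_encode (n, k)) (Suc v) \<in> set_decode w))"

lemma decidable_computes_rule:
  assumes "decidable A (\<lambda>z. Ans (p1 z) (p1 (p2 z)) (p2 (p2 z)))"
    and "computable A t" "computable A w" "computable A c" "computable A e" "computable A n" "computable A m"
  shows "decidable A (\<lambda>z. computes_rule Ans (t z) (w z) (c z) (e z) (n z) (m z))"
  unfolding computes_rule_def triple_fact_def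
  by (intro computability decidable_set_decode decidable_compose3[OF assms(1)]
      assms(2-)[THEN computable_compose])

lemma computes_rule_mono:
  assumes "computes_rule Ans t w c e n m" "t \<le> t'" "set_decode w \<subseteq> set_decode w'"
  shows "computes_rule Ans t' w' c e n m"
proof -
  have *: "x < t \<longrightarrow> x < t'" "x \<in> set_decode w \<longrightarrow> x \<in> set_decode w'" for x
    using assms(2,3) by auto
  have "computes_rule Ans t w c e n m \<longrightarrow> computes_rule Ans t' w' c e n m"
    unfolding computes_rule_def
    by (intro disj_mono conj_mono ex_mono all_mono imp_mono imp_refl *)
  with assms(1) show ?thesis by blast
qed

lemma computes_rule_Pairing:
  "p < t \<Longrightarrow> q < t \<Longrightarrow> triple_fact c p n a \<in> set_decode w \<Longrightarrow>
      triple_fact c q n b \<in> set_decode w \<Longrightarrow>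
      computes_rule Ans t w c (5 + 4 * prod_encode (p, q)) n (prod_encode (a, b))"
  unfolding computes_rule_def by (rule disjI2, rule disjI2, rule disjI2, rule disjI2, rule disjI2, rule disjI1, auto)

lemma computes_rule_Comp:
  "p < t \<Longrightarrow> q < t \<Longrightarrow> a < t \<Longrightarrow> triple_fact c q n a \<in> set_decode w \<Longrightarrow>
      triple_fact c p a m \<in> set_decode w \<Longrightarrow>
      computes_rule Ans t w c (6 + 4 * prod_encode (p, q)) n m"
  unfolding computes_rule_def by (rule disjI2, rule disjI2, rule disjI2, rule disjI2, rule disjI2, rule disjI2, rule disjI1, auto)

lemma computes_rule_Prec0:
  "p < t \<Longrightarrow> q < t \<Longrightarrow> triple_fact c p a m \<in> set_decode w \<Longrightarrow>
      computes_rule Ans t w c (7 + 4 * prod_encode (p, q)) (prod_encode (a, 0)) m"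
  unfolding computes_rule_def by (rule disjI2, rule disjI2, rule disjI2, rule disjI2, rule disjI2, rule disjI2, rule disjI2, rule disjI1, auto)

lemma computes_rule_PrecSuc:
  "p < t \<Longrightarrow> q < t \<Longrightarrow> k < t \<Longrightarrow> v < t \<Longrightarrow>
      triple_fact c (7 + 4 * prod_encode (p, q)) (prod_encode (a, k)) v \<in> set_decode w \<Longrightarrow>
      triple_fact c q (prod_encode (a, prod_encode (k, v))) m \<in> set_decode w \<Longrightarrow>
      computes_rule Ans t w c (7 + 4 * prod_encode (p, q)) (prod_encode (a, Suc k)) m"
  unfolding computes_rule_def by (rule disjI2, rule disjI2, rule disjI2, rule disjI2, rule disjI2, rule disjI2, rule disjI2, rule disjI1, auto)

lemma computes_rule_Mu:
  "p < t \<Longrightarrow> triple_fact c p (prod_encode (n, m)) 0 \<in> set_decode w \<Longrightarrow>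
      (\<And>k. k < m \<Longrightarrow> \<exists>v<t. triple_fact c p (prod_encode (n, k)) (Suc v) \<in> set_decode w) \<Longrightarrow>
      computes_rule Ans t w c (8 + 4 * p) n m"
  unfolding computes_rule_def by (rule disjI2, rule disjI2, rule disjI2, rule disjI2, rule disjI2, rule disjI2, rule disjI2, rule disjI2, auto)

text \<open>Soundness of one rule. Surjectivity of \<open>prog_num\<close> supplies programs for the
  numbers in the rule, and injectivity identifies them with the programs of the premises.\<close>

lemma computes_ruleE:
  assumes "computes_rule Ans t w c e n m"
    and "\<And>x. x \<in> set_decode w \<Longrightarrow>
      \<exists>c p n m. x = triple_fact c (prog_num p) n m \<and> computes (Ans c) p n m"
  shows "\<exists>p. e = prog_num p \<and> computes (Ans c) p n m"
proof -
  have fact: "\<exists>p. e = prog_num p \<and> computes (Ans c) p n m"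
    if "triple_fact c e n m \<in> set_decode w" for c e n m
    using assms(2)[OF that] by auto
  have fact': "computes (Ans c) p n m" if "triple_fact c (prog_num p) n m \<in> set_decode w" for c p n m
    using fact[OF that] by (auto dest: inj_prog_num)
  have surj: "\<exists>P. e = prog_num P" for e
    using surj_prog_num by metis
  from assms(1) show ?thesis
    unfolding computes_rule_def
  proof (elim disjE exE conjE, goal_cases)
    case 1 then show ?case by (intro exI[of _ prog.Zero]) (auto intro: computes.intros)
  next
    case 2 then show ?case by (intro exI[of _ prog.Succ]) (auto intro: computes.intros)
  next
    case 3 then show ?case by (intro exI[of _ prog.Left]) (auto intro: computes.intros)
  next
    case 4 then show ?case by (intro exI[of _ prog.Right]) (auto intro: computes.intros)
  next
    case 5 then show ?case by (intro exI[of _ prog.Query]) (auto intro: computes.intros)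
  next
    case (6 p q)
    then obtain P Q where "p = prog_num P" "q = prog_num Q" using surj by metis
    with 6 computes.Pairing[OF fact' fact', of c P n "p1 m" Q "p2 m"] show ?case
      by (intro exI[of _ "Pairing P Q"]) simp
  next
    case (7 p q a)
    then obtain P Q where "p = prog_num P" "q = prog_num Q" using surj by metis
    with 7 computes.Comp[OF fact' fact', of c Q n a P m] show ?case
      by (intro exI[of _ "Comp P Q"]) simp
  next
    case (8 p q)
    then obtain P Q where "p = prog_num P" "q = prog_num Q" using surj by metis
    moreover have "n = prod_encode (p1 n, 0)" using 8 by (metis prod.collapse prod_decode_inverse)
    ultimately show ?case using 8 computes.Prec0[OF fact', of c P "p1 n" m Q]
      by (intro exI[of _ "Prec P Q"]) simp
  next
    case (9 p q k v)
    then obtain P Q where "p = prog_num P" "q = prog_num Q" using surj by metis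
    moreover have "n = prod_encode (p1 n, Suc k)" using 9 by (metis prod.collapse prod_decode_inverse)
    ultimately show ?case
      using 9 computes.PrecSuc[OF fact' fact', of c P Q "p1 n" k v m]
      by (intro exI[of _ "Prec P Q"]) simp
  next
    case (10 p)
    then obtain P where P: "p = prog_num P" using surj by metis
    have "computes (Ans c) (Mu P) n m"
      using 10 fact' unfolding P by (intro computes.Mu) blast+
    with 10 P show ?case by (intro exI[of _ "Mu P"]) simp
  qed
qed

lemma triple_fact_rule_closureI:
  fixes Ans
  defines "C \<equiv> rule_closure (\<lambda>t w z.
    computes_rule Ans t w (p1 z) (p1 (p2 z)) (p1 (p2 (p2 z))) (p2 (p2 (p2 z))))"
  assumes "computes_rule Ans t (set_encode S) c e n m" "finite S" "S \<subseteq> C"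
  shows "triple_fact c e n m \<in> C"
  unfolding C_def
  by (rule rule_closureI[of "set_encode S" _ t])
    (use assms in \<open>auto simp: triple_fact_def set_encode_inverse\<close>)

text \<open>Completeness, by induction on the computation. In the compound cases the finite set
  \<open>?S\<close> collects the premises of the last step, and the bound is the successor of a sum
  dominating all its witnesses.\<close>

lemma computes_in_rule_closure:
  fixes Ans
  defines "C \<equiv> rule_closure (\<lambda>t w z.
    computes_rule Ans t w (p1 z) (p1 (p2 z)) (p1 (p2 (p2 z))) (p2 (p2 (p2 z))))"
  assumes "computes (Ans c) p n m"
  shows "triple_fact c (prog_num p) n m \<in> C"
  using assms(2)
proof induction
  case (Pairing p n a q b)
  let ?t = "Suc (prog_num p + prog_num q)"
    and ?S = "{triple_fact c (prog_num p) n a, triple_fact c (prog_num q) n b}"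
  have "computes_rule Ans ?t (set_encode ?S) c (prog_num (Pairing p q)) n (prod_encode (a, b))"
    unfolding prog_num.simps
    by (rule computes_rule_Pairing) (simp_all add: set_encode_inverse)
  then show ?case
    unfolding C_def by (rule triple_fact_rule_closureI) (use Pairing.IH C_def in auto)
next
  case (Comp q n a p b)
  let ?t = "Suc (prog_num p + prog_num q + a)"
    and ?S = "{triple_fact c (prog_num q) n a, triple_fact c (prog_num p) a b}"
  have "computes_rule Ans ?t (set_encode ?S) c (prog_num (Comp p q)) n b"
    unfolding prog_num.simps
    by (rule computes_rule_Comp[of _ _ _ a]) (simp_all add: set_encode_inverse)
  then show ?case
    unfolding C_def by (rule triple_fact_rule_closureI) (use Comp.IH C_def in auto)
next
  case (Prec0 p a v q)
  let ?t = "Suc (prog_num p + prog_num q)" and ?S = "{triple_fact c (prog_num p) a v}"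
  have "triple_fact c (prog_num p) a v \<in> set_decode (set_encode ?S)"
    by (subst set_encode_inverse) simp_all
  then have "computes_rule Ans ?t (set_encode ?S) c (prog_num (Prec p q)) (prod_encode (a, 0)) v"
    unfolding prog_num.simps by (intro computes_rule_Prec0) simp_all
  then show ?case
    unfolding C_def by (rule triple_fact_rule_closureI) (use Prec0.IH C_def in auto)
next
  case (PrecSuc p q a k v u)
  let ?t = "Suc (prog_num p + prog_num q + k + v)"
    and ?S = "{triple_fact c (prog_num (Prec p q)) (prod_encode (a, k)) v,
            triple_fact c (prog_num q) (prod_encode (a, prod_encode (k, v))) u}"
  have "computes_rule Ans ?t (set_encode ?S) c (prog_num (Prec p q)) (prod_encode (a, Suc k)) u"
    unfolding prog_num.simps
    by (rule computes_rule_PrecSuc[of _ _ _ _ v]) (simp_all add: set_encode_inverse)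
  then show ?case
    unfolding C_def by (rule triple_fact_rule_closureI) (use PrecSuc.IH C_def in auto)
next
  case (Mu p n m)
  then obtain v where v: "\<And>k. k < m \<Longrightarrow> triple_fact c (prog_num p) (prod_encode (n, k)) (Suc (v k)) \<in> C"
    by metis
  define t where "t = Suc (prog_num p + (\<Sum>k<m. v k))"
  have t: "v k < t" if "k < m" for k
    using that member_le_sum[of k "{..<m}" v] by (simp add: t_def)
  let ?S = "insert (triple_fact c (prog_num p) (prod_encode (n, m)) 0)
             ((\<lambda>k. triple_fact c (prog_num p) (prod_encode (n, k)) (Suc (v k))) ` {..<m})"
  have "computes_rule Ans t (set_encode ?S) c (prog_num (prog.Mu p)) n m"
    unfolding prog_num.simps
  proof (rule computes_rule_Mu)
    show "\<exists>v<t. triple_fact c (prog_num p) (prod_encode (n, k)) (Suc v) \<in> set_decode (set_encode ?S)"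
      if "k < m" for k
      by (rule exI[of _ "v k"]) (use t that in \<open>auto simp: set_encode_inverse\<close>)
  qed (auto simp: set_encode_inverse t_def)
  then show ?case
    unfolding C_def by (rule triple_fact_rule_closureI) (use Mu.IH(1) v C_def in auto)
qed (unfold C_def, (rule triple_fact_rule_closureI[of _ 0 "{}"]; simp add: computes_rule_def)+)

text \<open>Enumerability of self-halting, uniformly in an oracle index. It is used with one fixed
  set as oracle, for the jump, and with finite segments as indices, for forcing.\<close>

lemma ce_halts:
  assumes "decidable A (\<lambda>z. Ans (p1 z) (p1 (p2 z)) (p2 (p2 z)))"
  shows "ce A (\<lambda>z. \<exists>p m. prog_num p = p2 z \<and> computes (Ans (p1 z)) p (p2 z) m)"
proof -
  define \<Phi> where "\<Phi> = (\<lambda>t w z.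
    computes_rule Ans t w (p1 z) (p1 (p2 z)) (p1 (p2 (p2 z))) (p2 (p2 (p2 z))))"
  have "decidable A (\<lambda>z. \<Phi> (p1 z) (p1 (p2 z)) (p2 (p2 z)))"
    unfolding \<Phi>_def by (intro decidable_computes_rule assms computability)
  then have "ce A (\<lambda>z. z \<in> rule_closure \<Phi>)"
    by (rule ce_rule_closure) (unfold \<Phi>_def, rule computes_rule_mono)
  then have "ce A (\<lambda>z. \<exists>m. triple_fact (p1 z) (p2 z) (p2 z) m \<in> rule_closure \<Phi>)"
    unfolding triple_fact_def 
    by (intro ce_ex, rule ce_compose[of A "\<lambda>z. z \<in> rule_closure \<Phi>"]) (intro computability)
  moreover have "triple_fact c e n m \<in> rule_closure \<Phi> \<longleftrightarrow>
      (\<exists>p. prog_num p = e \<and> computes (Ans c) p n m)" for c e n m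
  proof
    have "\<exists>c p n m. z = triple_fact c (prog_num p) n m \<and> computes (Ans c) p n m"
      if "z \<in> rule_closure \<Phi>" for z
      using that
    proof induction
      case (rule_closureI w t z)
      then obtain p where "p1 (p2 z) = prog_num p" and
          "computes (Ans (p1 z)) p (p1 (p2 (p2 z))) (p2 (p2 (p2 z)))"
        unfolding \<Phi>_def by (metis (no_types, lifting) computes_ruleE)
      moreover have "z = triple_fact (p1 z) (prog_num p) (p1 (p2 (p2 z))) (p2 (p2 (p2 z)))"
        unfolding triple_fact_def calculation(1)[symmetric] by simp
      ultimately show ?case by metis
    qed
    then show "triple_fact c e n m \<in> rule_closure \<Phi> \<Longrightarrow> \<exists>p. prog_num p = e \<and> computes (Ans c) p n m"
      by fastforce
  next
    assume "\<exists>p. prog_num p = e \<and> computes (Ans c) p n m"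
    then show "triple_fact c e n m \<in> rule_closure \<Phi>"
      using computes_in_rule_closure unfolding \<Phi>_def by blast
  qed
  then have "(\<lambda>z. \<exists>p m. prog_num p = p2 z \<and> computes (Ans (p1 z)) p (p2 z) m) =
      (\<lambda>z. \<exists>m. triple_fact (p1 z) (p2 z) (p2 z) m \<in> rule_closure \<Phi>)"
    by (intro ext) blast
  ultimately show ?thesis by simp
qed

lemma ce_jump: "ce A (\<lambda>e. e \<in> jump A)"
proof -
  have "decidable A (\<lambda>z. answers A (p1 (p2 z)) (p2 (p2 z)))"
    by (intro computability decidable_oracle)
  \<comment> \<open>The oracle does not depend on its index here, so \<open>e\<close> may fill both
    components.\<close>
  from ce_compose[OF ce_halts[OF this] computable_pair[OF computable_id computable_id]]
  have "ce A (\<lambda>e. \<exists>p m. prog_num p = e \<and> computes (answers A) p e m)" by simp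
  then show ?thesis by (simp add: jump_def flip: eval_iff_computes)
qed

lemma jump_mono: "A \<le>\<^sub>T B \<Longrightarrow> jump A \<le>\<^sub>T jump B"
  unfolding turing_le_iff_decidable[of "jump A"] by (rule decidable_jump, rule ce_trans, assumption, rule ce_jump)

lemma low_mono: "A \<le>\<^sub>T B \<Longrightarrow> low B \<Longrightarrow> low A"
  unfolding low_def using jump_mono turing_le_trans by blast

section \<open>Limit partners and bushy trees\<close>

lemma rainbow_subset: "rainbow f R \<Longrightarrow> S \<subseteq> R \<Longrightarrow> rainbow f S"
  unfolding rainbow_def pairs_def by (rule inj_on_subset) auto

text \<open>For finite \<open>F\<close> and a two-bounded rainbow-stable \<open>f\<close> this says
  that \<open>F\<close> is a rainbow in which no two elements are limit partners. In this form the
  condition needs no mention of partners.\<close>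

definition extendible :: "(nat \<Rightarrow> nat \<Rightarrow> nat) \<Rightarrow> nat set \<Rightarrow> bool" where
  "extendible f F \<longleftrightarrow> (\<forall>\<^sub>\<infinity>s. rainbow f (insert s F))"

lemma extendible_rainbow: "extendible f F \<Longrightarrow> rainbow f F"
  unfolding extendible_def by (auto dest!: eventually_happens intro: rainbow_subset)

lemma two_boundedD:
  assumes "two_bounded f" "a < u" "b < u" "c < u" "f a u = f b u" "f a u = f c u"
  shows "a = b \<or> a = c \<or> b = c"
proof (rule ccontr)
  assume "\<not> ?thesis"
  then have "card {(a, u), (b, u), (c, u)} = 3" by auto
  moreover have "card {(a, u), (b, u), (c, u)} \<le> card {(x, s) \<in> pairs UNIV. f x s = f a u}"
    using assms by (intro card_mono) (auto simp: pairs_def two_bounded_def)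
  moreover have "card {(x, s) \<in> pairs UNIV. f x s = f a u} \<le> 2"
    using assms(1) unfolding two_bounded_def by blast
  ultimately show False by linarith
qed

text \<open>A rainbow \<open>insert s F\<close> fails to be extendible only if \<open>s\<close> is the limit partner of some element
  of \<open>F\<close>, and by two-boundedness every element has at most one partner.\<close>

lemma limit_partner:
  assumes f: "two_bounded f" "rainbow_stable f" and F: "finite F" "extendible f F"
    and s: "rainbow f (insert s F)" "\<not> extendible f (insert s F)"
  shows "\<exists>a\<in>F. a \<noteq> s \<and> (\<forall>\<^sub>\<infinity>u. a < u \<and> s < u \<and> f a u = f s u)"
proof -
  \<comment> \<open>\<open>U\<close> holds the columns in which a color of a pair from
    \<open>insert s F\<close> occurs. It is finite by two-boundedness; for \<open>u\<close> outside,
    a pair ending in \<open>u\<close> can only collide with another pair ending in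
    \<open>u\<close>.\<close>
  define U where "U = (\<Union>(c, d)\<in>pairs (insert s F). snd ` {(x, u) \<in> pairs UNIV. f x u = f c d})"
  have "pairs (insert s F) \<subseteq> insert s F \<times> insert s F" by (auto simp: pairs_def)
  then have "finite (pairs (insert s F))" using F(1) by (meson finite.insertI finite_SigmaI finite_subset)
  then have "finite U" using f(1) unfolding U_def two_bounded_def by auto
  have "\<forall>\<^sub>\<infinity>u. u \<notin> U \<union> (\<Union>x\<in>insert s F. {..x})"
    using \<open>finite U\<close> F(1) by (simp add: eventually_cofinite)
  then have U: "\<forall>\<^sub>\<infinity>u. u \<notin> U \<and> (\<forall>x\<in>insert s F. x < u)"
    by eventually_elim (auto simp: not_le)
  have "\<exists>\<^sub>\<infinity>u. \<not> rainbow f (insert u (insert s F))"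
    using s(2) by (simp add: extendible_def not_eventually)
  moreover have "\<forall>\<^sub>\<infinity>u. \<not> rainbow f (insert u (insert s F)) \<longrightarrow> (\<exists>a\<in>F. a \<noteq> s \<and> a < u \<and> s < u \<and> f a u = f s u)"
    using U F(2)[unfolded extendible_def]
  proof eventually_elim
    case (elim u)
    show ?case
    proof
      assume "\<not> rainbow f (insert u (insert s F))"
      then obtain a b c d where ab: "(a, b) \<in> pairs (insert u (insert s F))"
          "(c, d) \<in> pairs (insert u (insert s F))" "(a, b) \<noteq> (c, d)" "f a b = f c d"
        by (auto simp: rainbow_def inj_on_def)
      have U': "False" if "(x, u) \<in> pairs UNIV" "(y, z) \<in> pairs (insert s F)" "f x u = f y z" for x y z
        using that elim unfolding U_def by force
      have mem: "x \<in> insert s F" "y = u \<or> (x, y) \<in> pairs (insert s F)" "(x, y) \<in> pairs UNIV"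
        if "(x, y) \<in> pairs (insert u (insert s F))" for x y
        using that elim by (auto simp: pairs_def)
      have "\<not> ((a, b) \<in> pairs (insert s F) \<and> (c, d) \<in> pairs (insert s F))"
        using s(1) ab unfolding rainbow_def inj_on_def by fastforce
      then have u: "b = u" "d = u"
        using mem[OF ab(1)] mem[OF ab(2)] U' ab(4) by metis+
      \<comment> \<open>A collision between two elements of \<open>F\<close> is excluded because
        \<open>insert u F\<close> is a rainbow, so one side of the collision is
        \<open>s\<close>.\<close>
      have "\<not> (a \<in> F \<and> c \<in> F)"
      proof
        assume "a \<in> F \<and> c \<in> F"
        then have "(a, u) \<in> pairs (insert u F)" "(c, u) \<in> pairs (insert u F)"
          using ab unfolding u by (auto simp: pairs_def)
        with elim(2) ab show False unfolding u rainbow_def inj_on_def by fastforce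
      qed
      then show "\<exists>a\<in>F. a \<noteq> s \<and> a < u \<and> s < u \<and> f a u = f s u"
        using mem(1)[OF ab(1)] mem(1)[OF ab(2)] ab elim(1) unfolding u by auto
    qed
  qed
  ultimately have "\<exists>\<^sub>\<infinity>u. \<exists>a\<in>F. a \<noteq> s \<and> a < u \<and> s < u \<and> f a u = f s u"
    by (rule frequently_rev_mp)
  \<comment> \<open>\<open>F\<close> is finite, so one \<open>a\<close> collides with
    \<open>s\<close> infinitely often. Stability then upgrades this to almost always:
    two-boundedness forces a limit partner of \<open>a\<close> to be \<open>s\<close>, and having no
    partner in the limit contradicts the collisions.\<close>
  then obtain a where a: "a \<in> F" "\<exists>\<^sub>\<infinity>u. a \<noteq> s \<and> a < u \<and> s < u \<and> f a u = f s u"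
    using F(1) by (auto simp: frequently_bex_finite_distrib)
  then have "a \<noteq> s" by (auto dest: frequently_ex)
  have "\<forall>\<^sub>\<infinity>u. a < u \<and> s < u \<and> f a u = f s u"
    using f(2)[unfolded rainbow_stable_def, rule_format, of a]
  proof
    assume "\<exists>y. y \<noteq> a \<and> (\<forall>\<^sub>\<infinity>u. a < u \<and> y < u \<and> f a u = f y u)"
    then obtain y where y: "y \<noteq> a" "\<forall>\<^sub>\<infinity>u. a < u \<and> y < u \<and> f a u = f y u" by blast
    obtain u where "a < u \<and> y < u \<and> f a u = f y u" "a \<noteq> s \<and> a < u \<and> s < u \<and> f a u = f s u"
      using frequently_ex[OF frequently_eventually_frequently[OF a(2) y(2)]] by blast
    then have "y = s" using two_boundedD[OF f(1), of a u y s] y(1) by auto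
    with y show ?thesis by simp
  next
    assume "\<forall>\<^sub>\<infinity>u. a < u \<and> \<not> (\<exists>y. y \<noteq> a \<and> y < u \<and> f a u = f y u)"
    from frequently_ex[OF frequently_eventually_frequently[OF a(2) this]] show ?thesis by metis
  qed
  with a(1) \<open>a \<noteq> s\<close> show ?thesis by blast
qed

text \<open>Send each \<open>s\<close> in \<open>B\<close> to an element of \<open>F\<close> whose
  limit partner it is. A late column in which two values of \<open>s\<close> shared the same element
  would contain three pairs of one color, so the map is injective.\<close>

lemma not_extendible_insert:
  assumes f: "two_bounded f" "rainbow_stable f" and F: "finite F" "extendible f F"
  defines "B \<equiv> {s. rainbow f (insert s F) \<and> \<not> extendible f (insert s F)}"
  shows "finite B" "card B \<le> card F"
proof -
  have "\<forall>s\<in>B. \<exists>a. a \<in> F \<and> a \<noteq> s \<and> (\<forall>\<^sub>\<infinity>u. a < u \<and> s < u \<and> f a u = f s u)"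
    using limit_partner[OF f F] unfolding B_def by blast
  from bchoice[OF this] obtain g where g: "\<And>s. s \<in> B \<Longrightarrow> g s \<in> F" "\<And>s. s \<in> B \<Longrightarrow> g s \<noteq> s"
    "\<And>s. s \<in> B \<Longrightarrow> \<forall>\<^sub>\<infinity>u. g s < u \<and> s < u \<and> f (g s) u = f s u"
    by blast
  have "inj_on g B"
  proof (rule inj_onI)
    fix s t assume st: "s \<in> B" "t \<in> B" "g s = g t"
    obtain u where "g s < u \<and> s < u \<and> f (g s) u = f s u" "g t < u \<and> t < u \<and> f (g t) u = f t u"
      using eventually_happens[OF eventually_conj[OF g(3)[OF st(1)] g(3)[OF st(2)]]]
      by auto
    then show "s = t"
      using two_boundedD[OF f(1), of "g s" u s t] g(2)[OF st(1)] g(2)[OF st(2)] st(3) by auto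
  qed
  moreover have "g ` B \<subseteq> F" using g(1) by blast
  ultimately show "finite B" "card B \<le> card F"
    using F(1) inj_on_finite[of g B F] card_inj_on_le[of g B F] by simp_all
qed

section \<open>Bushy trees on codes of finite sets\<close>

lemma set_decode_le: "x \<in> set_decode n \<Longrightarrow> 2 ^ x \<le> n"
  unfolding set_decode_def by (metis div_less even_zero mem_Collect_eq not_le)

lemma set_decode_less: "x \<in> set_decode n \<Longrightarrow> x < n"
  using set_decode_le less_exp less_le_trans by blast

lemma card_set_decode_le: "card (set_decode n) \<le> n"
  using card_mono[of "{..<n}" "set_decode n"] set_decode_less by auto

lemma set_decode_snoc: "n < 2 ^ s \<Longrightarrow> set_decode (2 ^ s + n) = insert s (set_decode n)"
  by (rule set_decode_plus_power_2) (use set_decode_le in force)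

text \<open>Finite sets are identified with their codes; the extensions \<open>2 ^ s + \<sigma>\<close> with \<open>\<sigma> < 2 ^ s\<close> are the
  one-point end-extensions of \<open>\<sigma>\<close>.  The threshold \<open>k * Suc \<sigma>\<close> exceeds the number of elements
  of \<open>\<sigma>\<close>, and thus of their limit partners.\<close>

inductive big :: "(nat \<Rightarrow> bool) \<Rightarrow> nat \<Rightarrow> nat \<Rightarrow> bool" for C k where
  leaf: "C \<sigma> \<Longrightarrow> big C k \<sigma>"
| node: "finite S \<Longrightarrow> k * Suc \<sigma> \<le> card S \<Longrightarrow> (\<And>s. s \<in> S \<Longrightarrow> \<sigma> < 2 ^ s \<and> big C k (2 ^ s + \<sigma>)) \<Longrightarrow> big C k \<sigma>"

text \<open>Pigeonhole at each node: every child is big for \<open>B\<close> or for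
  \<open>C\<close>, and the required branching is linear in the threshold, so one of the two groups
  of children is large enough.\<close>

lemma big_union:
  assumes "big (\<lambda>\<sigma>. B \<sigma> \<or> C \<sigma>) (k + l) \<sigma>"
  shows "big B k \<sigma> \<or> big C l \<sigma>"
  using assms
proof induction
  case (leaf \<sigma>)
  then show ?case by (auto intro: big.leaf)
next
  case (node S \<sigma>)
  define S1 where "S1 = {s \<in> S. big B k (2 ^ s + \<sigma>)}"
  define S2 where "S2 = {s \<in> S. big C l (2 ^ s + \<sigma>)}"
  have "S = S1 \<union> S2" using node(3) unfolding S1_def S2_def by blast
  then have "card S \<le> card S1 + card S2" by (simp add: card_Un_le)
  with node(2) have "k * Suc \<sigma> + l * Suc \<sigma> \<le> card S1 + card S2" by (simp add: add_mult_distrib)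
  then consider "k * Suc \<sigma> \<le> card S1" | "l * Suc \<sigma> \<le> card S2" by linarith
  then show ?case
  proof cases
    case 1
    have "big B k \<sigma>" by (rule big.node[OF _ 1]) (use node(1,3) in \<open>auto simp: S1_def\<close>)
    then show ?thesis ..
  next
    case 2
    have "big C l \<sigma>" by (rule big.node[OF _ 2]) (use node(1,3) in \<open>auto simp: S2_def\<close>)
    then show ?thesis ..
  qed
qed

text \<open>The start of the construction, when nothing is forbidden yet. Positivity excludes the
  empty set of children, which would make every node big.\<close>

lemma not_big_False: "0 < k \<Longrightarrow> \<not> big (\<lambda>_. False) k \<sigma>"
proof
  assume "big (\<lambda>_. False) k \<sigma>" "0 < k"
  then show False
  proof induction
    case (node S \<sigma>)
    then have "S \<noteq> {}" by auto
    with node show ?case by blast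
  qed
qed

text \<open>Being a rainbow passes from a set to its subsets, so it descends from a leaf to the
  root; a positive threshold guarantees that there is a child to descend from.\<close>

lemma big_rainbow:
  assumes "big C k \<sigma>" "\<And>\<tau>. C \<tau> \<Longrightarrow> rainbow f (set_decode \<tau>)" "0 < k"
  shows "rainbow f (set_decode \<sigma>)"
  using assms(1)
proof induction
  case (node S \<sigma>)
  from node(2) assms(3) have "S \<noteq> {}" by auto
  then obtain s where "\<sigma> < 2 ^ s" "rainbow f (set_decode (2 ^ s + \<sigma>))" using node(3) by blast
  then have "rainbow f (insert s (set_decode \<sigma>))" by (simp add: set_decode_snoc)
  then show ?case by (rule rainbow_subset) blast
qed (rule assms(2))

text \<open>The bounded quantifiers make the relation decidable by the closure rules.
  \<open>\<sigma> < 2 ^ x\<close> says that \<open>x\<close> lies above every element of the set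
  coded by \<sigma>.\<close>

definition end_ext :: "nat \<Rightarrow> nat \<Rightarrow> bool" where
  "end_ext \<sigma> \<tau> \<longleftrightarrow> \<sigma> \<le> \<tau> \<and> (\<forall>x<\<sigma>. x \<in> set_decode \<sigma> \<longrightarrow> x \<in> set_decode \<tau>) \<and>
     (\<forall>x<\<tau>. x \<in> set_decode \<tau> \<longrightarrow> x \<in> set_decode \<sigma> \<or> \<sigma> < 2 ^ x)"

lemma end_ext_iff:
  "end_ext \<sigma> \<tau> \<longleftrightarrow> \<sigma> \<le> \<tau> \<and> set_decode \<sigma> \<subseteq> set_decode \<tau> \<and>
     (\<forall>x\<in>set_decode \<tau>. x \<in> set_decode \<sigma> \<or> \<sigma> < 2 ^ x)"
  unfolding end_ext_def using set_decode_less by blast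

lemma end_ext_refl: "end_ext \<sigma> \<sigma>"
  by (simp add: end_ext_iff)

lemma end_ext_trans: "end_ext \<rho> \<sigma> \<Longrightarrow> end_ext \<sigma> \<tau> \<Longrightarrow> end_ext \<rho> \<tau>"
  unfolding end_ext_iff by (meson le_less_trans order_trans subsetD)

lemma end_ext_snoc: "\<sigma> < 2 ^ s \<Longrightarrow> end_ext \<sigma> (2 ^ s + \<sigma>)"
  by (auto simp: end_ext_iff set_decode_snoc)

text \<open>Almost every \<open>s\<close> works: only finitely many children can be big, as
  otherwise \<sigma> would be big itself, and only finitely many are lost to limit partners. This is
  what makes the stems grow.\<close>

lemma not_big_snoc:
  assumes f: "two_bounded f" "rainbow_stable f"
    and \<sigma>: "extendible f (set_decode \<sigma>)" "\<not> big B k \<sigma>"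
  shows "\<exists>s. \<sigma> < 2 ^ s \<and> extendible f (set_decode (2 ^ s + \<sigma>)) \<and> \<not> big B k (2 ^ s + \<sigma>)"
proof -
  define X where "X = {s. \<sigma> < 2 ^ s \<and> big B k (2 ^ s + \<sigma>)}"
  have "finite X"
  proof (rule ccontr)
    assume "infinite X"
    then obtain S where "S \<subseteq> X" "finite S" "card S = k * Suc \<sigma>"
      by (meson infinite_arbitrarily_large)
    then have "big B k \<sigma>" by (intro big.node[of S]) (auto simp: X_def)
    with \<sigma>(2) show False ..
  qed
  define Y where "Y = {s. rainbow f (insert s (set_decode \<sigma>)) \<and> \<not> extendible f (insert s (set_decode \<sigma>))}"
  have "finite Y"
    unfolding Y_def by (rule not_extendible_insert[OF f finite_set_decode \<sigma>(1)])
  have "\<forall>\<^sub>\<infinity>s. s \<notin> X \<union> Y \<union> {..\<sigma>}"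
    using \<open>finite X\<close> \<open>finite Y\<close> by (simp add: eventually_cofinite)
  with \<sigma>(1) have "\<forall>\<^sub>\<infinity>s. s \<notin> X \<union> Y \<union> {..\<sigma>} \<and> rainbow f (insert s (set_decode \<sigma>))"
    unfolding extendible_def by (intro eventually_conj)
  then obtain s where s: "s \<notin> X" "s \<notin> Y" "\<sigma> < s" "rainbow f (insert s (set_decode \<sigma>))"
    by (auto dest!: eventually_happens)
  then have "\<sigma> < 2 ^ s" using less_exp[of s] by linarith
  with s show ?thesis by (auto simp: X_def Y_def set_decode_snoc)
qed

text \<open>Walk up the tree, keeping both conditions. Of at least
  \<open>Suc k * Suc \<sigma>\<close> children, fewer than \<open>k * Suc \<sigma>\<close> are big
  for \<open>B\<close> and at most \<sigma> are not extendible, so some child is neither.\<close>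

lemma big_avoid:
  assumes f: "two_bounded f" "rainbow_stable f"
    and C: "\<And>\<tau>. C \<tau> \<Longrightarrow> rainbow f (set_decode \<tau>)"
    and \<sigma>: "big C (Suc k) \<sigma>" "extendible f (set_decode \<sigma>)" "\<not> big B k \<sigma>"
  shows "\<exists>\<tau>. end_ext \<sigma> \<tau> \<and> C \<tau> \<and> extendible f (set_decode \<tau>) \<and> \<not> big B k \<tau>"
  using \<sigma>
proof induction
  case (leaf \<sigma>)
  then show ?case using end_ext_refl by blast
next
  case (node S \<sigma>)
  define S1 where "S1 = {s \<in> S. big B k (2 ^ s + \<sigma>)}"
  define S2 where "S2 = {s \<in> S. \<not> extendible f (set_decode (2 ^ s + \<sigma>))}"
  define Y where "Y = {s. rainbow f (insert s (set_decode \<sigma>)) \<and> \<not> extendible f (insert s (set_decode \<sigma>))}"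
  have Y: "finite Y" "card Y \<le> card (set_decode \<sigma>)"
    unfolding Y_def by (rule not_extendible_insert[OF f finite_set_decode node(4)])+
  have "S2 \<subseteq> Y"
  proof
    fix s assume "s \<in> S2"
    with node(3) have "\<sigma> < 2 ^ s" "big C (Suc k) (2 ^ s + \<sigma>)" "\<not> extendible f (set_decode (2 ^ s + \<sigma>))"
      unfolding S2_def by blast+
    \<comment> \<open>The child carries a tree whose leaves are rainbows and so is a rainbow itself;
      failing to be extendible, it is one of the counted partners.\<close>
    moreover from this(2) have "rainbow f (set_decode (2 ^ s + \<sigma>))"
      by (rule big_rainbow) (simp_all add: C)
    ultimately show "s \<in> Y" by (simp add: Y_def set_decode_snoc)
  qed
  then have "card S2 \<le> \<sigma>"
    using card_mono[OF Y(1)] Y(2) card_set_decode_le[of \<sigma>] by (meson order_trans)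
  moreover have "card S1 < k * Suc \<sigma>"
  proof (rule ccontr)
    assume "\<not> ?thesis"
    then have "big B k \<sigma>" by (intro big.node[of S1]) (use node(1,3) in \<open>auto simp: S1_def\<close>)
    with node(5) show False ..
  qed
  ultimately have "card (S1 \<union> S2) < card S"
    using node(2) card_Un_le[of S1 S2] by simp
  moreover have "finite (S1 \<union> S2)" using node(1) by (simp add: S1_def S2_def)
  ultimately have "\<not> S \<subseteq> S1 \<union> S2" using card_mono[of "S1 \<union> S2" S] by linarith
  then obtain s where "s \<in> S" "s \<notin> S1 \<union> S2" by blast
  then obtain \<tau> where "\<sigma> < 2 ^ s" "end_ext (2 ^ s + \<sigma>) \<tau>" "C \<tau>" "extendible f (set_decode \<tau>)" "\<not> big B k \<tau>"
    using node(3)[of s] unfolding S1_def S2_def by blast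
  then show ?case using end_ext_trans[OF end_ext_snoc] by blast
qed

text \<open>Bigness is a rule closure on coded triples of parameter, threshold and node: a node is
  derived from a witness that it is a leaf, or from enough derived children. The parameter and
  threshold are part of the input since both vary during the construction.\<close>

lemma ce_big:
  assumes "ce A (\<lambda>z. C (p1 z) (p2 z))"
  shows "ce A (\<lambda>z. big (C (p1 z)) (p1 (p2 z)) (p2 (p2 z)))"
proof -
  obtain Q where Q: "decidable A (\<lambda>z. Q (p1 z) (p2 z))" "\<And>n. C (p1 n) (p2 n) \<longleftrightarrow> (\<exists>m. Q n m)"
    using assms by (elim ceE) blast
  \<comment> \<open>The children of the node in \<open>z\<close> that are already derived, with
    parameter and threshold unchanged.\<close>
  define ch where "ch w z s \<longleftrightarrow> p2 (p2 z) < 2 ^ s \<and>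
    prod_encode (p1 z, prod_encode (p1 (p2 z), 2 ^ s + p2 (p2 z))) \<in> set_decode w" for w z s
  define \<Phi> where "\<Phi> t w z \<longleftrightarrow> (\<exists>m<t. Q (prod_encode (p1 z, p2 (p2 z))) m) \<or>
    p1 (p2 z) * Suc (p2 (p2 z)) \<le> card {s. s < t \<and> ch w z s}" for t w z
  have "decidable A (\<lambda>z. \<Phi> (p1 z) (p1 (p2 z)) (p2 (p2 z)))"
    unfolding \<Phi>_def ch_def
    by (intro computability decidable_set_decode decidable_compose2[OF Q(1)])
  then have "ce A (\<lambda>z. z \<in> rule_closure \<Phi>)"
  proof (rule ce_rule_closure)
    fix t t' w w' z assume *: "\<Phi> t w z" "t \<le> t'" "set_decode w \<subseteq> set_decode w'"
    have "card {s. s < t \<and> ch w z s} \<le> card {s. s < t' \<and> ch w' z s}"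
      using *(2,3) by (intro card_mono) (auto simp: ch_def)
    with * show "\<Phi> t' w' z" unfolding \<Phi>_def by (meson less_le_trans order_trans)
  qed
  moreover have "z \<in> rule_closure \<Phi> \<longleftrightarrow> big (C (p1 z)) (p1 (p2 z)) (p2 (p2 z))" for z
  proof
    assume "z \<in> rule_closure \<Phi>"
    then show "big (C (p1 z)) (p1 (p2 z)) (p2 (p2 z))"
    proof induction
      case (rule_closureI w t z)
      have IH: "big (C (p1 z)) (p1 (p2 z)) (2 ^ s + p2 (p2 z))" if "ch w z s" for s
        using rule_closureI.IH[of "prod_encode (p1 z, prod_encode (p1 (p2 z), 2 ^ s + p2 (p2 z)))"]
          that by (simp add: ch_def)
      from rule_closureI(2) show ?case
        unfolding \<Phi>_def
      proof
        assume "\<exists>m<t. Q (prod_encode (p1 z, p2 (p2 z))) m"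
        then show ?thesis using Q(2)[of "prod_encode (p1 z, p2 (p2 z))"] by (auto intro: big.leaf)
      next
        assume "p1 (p2 z) * Suc (p2 (p2 z)) \<le> card {s. s < t \<and> ch w z s}"
        then show ?thesis
          by (intro big.node[of "{s. s < t \<and> ch w z s}"]) (use IH in \<open>auto simp: ch_def\<close>)
      qed
    qed
  next
    have "prod_encode (\<beta>, prod_encode (k, \<sigma>)) \<in> rule_closure \<Phi>" if "big (C \<beta>) k \<sigma>" for \<beta> k \<sigma>
      using that
    proof induction
      case (leaf \<sigma>)
      then obtain m where "Q (prod_encode (\<beta>, \<sigma>)) m" using Q(2)[of "prod_encode (\<beta>, \<sigma>)"] by auto
      then have "\<Phi> (Suc m) 0 (prod_encode (\<beta>, prod_encode (k, \<sigma>)))" by (auto simp: \<Phi>_def)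
      then show ?case by (rule rule_closure.intros[rotated]) simp
    next
      case (node S \<sigma>)
      define W where "W = (\<lambda>s. prod_encode (\<beta>, prod_encode (k, 2 ^ s + \<sigma>))) ` S"
      define t where "t = Suc (Max S)"
      let ?z = "prod_encode (\<beta>, prod_encode (k, \<sigma>))"
      have W: "set_decode (set_encode W) = W"
        using node(1) by (intro set_encode_inverse) (simp add: W_def)
      have "S \<subseteq> {s. s < t \<and> ch (set_encode W) ?z s}"
        unfolding ch_def W using node(1,3) by (auto simp: W_def t_def less_Suc_eq_le)
      then have "card S \<le> card {s. s < t \<and> ch (set_encode W) ?z s}"
        by (intro card_mono) auto
      with node(2) have "\<Phi> t (set_encode W) ?z" by (simp add: \<Phi>_def)
      then show ?case
        by (rule rule_closure.intros[rotated]) (use node(3) W in \<open>auto simp: W_def\<close>)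
    qed
    from this[of "p1 z" "p1 (p2 z)" "p2 (p2 z)"]
    show "big (C (p1 z)) (p1 (p2 z)) (p2 (p2 z)) \<Longrightarrow> z \<in> rule_closure \<Phi>" by simp
  qed
  ultimately show ?thesis by simp
qed

section \<open>Low rainbows\<close>

lemma join_iff:
  "2 * n \<in> join A B \<longleftrightarrow> n \<in> A" "Suc (2 * n) \<in> join A B \<longleftrightarrow> n \<in> B"
  unfolding join_def by (auto, presburger+)

lemma coloring_graph_iff: "prod_encode (prod_encode (x, s), c) \<in> coloring_graph f \<longleftrightarrow> x < s \<and> c = f x s"
  by (auto simp: coloring_graph_def)

lemma rainbow_iff:
  "rainbow f R \<longleftrightarrow> (\<forall>a\<in>R. \<forall>b\<in>R. \<forall>c\<in>R. \<forall>d\<in>R. a < b \<and> c < d \<and> f a b = f c d \<longrightarrow> a = c \<and> b = d)"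
  by (simp add: rainbow_def pairs_def inj_on_def Ball_def split_paired_All) blast

lemma decidable_rainbow:
  assumes "coloring_graph f \<le>\<^sub>T A" "computable A u" "computable A \<sigma>"
  shows "decidable A (\<lambda>z. rainbow f (insert (u z) (set_decode (\<sigma> z))))"
proof -
  \<comment> \<open>Recovers the color from the graph by search. The disjunct for
    \<open>x \<ge> s\<close> makes the search total, with default value 0.\<close>
  define F where "F x s = (LEAST c. \<not> x < s \<or> prod_encode (prod_encode (x, s), c) \<in> coloring_graph f)" for x s
  have "decidable A (\<lambda>n. n \<in> coloring_graph f)"
    using assms(1) by (simp add: turing_le_iff_decidable)
  note graph = decidable_compose[OF this]
  have F: "computable A (\<lambda>z. F (p1 z) (p2 z))"
    unfolding F_def
  proof (rule computable_Least)
    show "\<exists>c. \<not> p1 z < p2 z \<or> prod_encode (prod_encode (p1 z, p2 z), c) \<in> coloring_graph f" for z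
      unfolding coloring_graph_iff by blast
  qed (intro computability graph)
  have F_eq: "F x s = f x s" if "x < s" for x s
    unfolding F_def by (rule Least_equality) (use that in \<open>auto simp: coloring_graph_iff\<close>)
  define mem where "mem u \<sigma> x \<longleftrightarrow> x = u \<or> x \<in> set_decode \<sigma>" for u \<sigma> x
  have mem_iff: "x \<in> insert u (set_decode \<sigma>) \<longleftrightarrow> mem u \<sigma> x" for u \<sigma> x
    by (simp add: mem_def)
  \<comment> \<open>\<open>Suc (u + \<sigma>)\<close> exceeds \<open>u\<close> and every element of
    the set coded by \<sigma>, which bounds all four quantifiers below.\<close>
  have mem: "mem u \<sigma> x \<Longrightarrow> x < Suc (u + \<sigma>)" for u \<sigma> x
    unfolding mem_def using set_decode_less[of x \<sigma>] by auto
  have "rainbow f (insert u (set_decode \<sigma>)) \<longleftrightarrow>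
      (\<forall>a<Suc (u + \<sigma>). \<forall>b<Suc (u + \<sigma>). \<forall>c<Suc (u + \<sigma>). \<forall>d<Suc (u + \<sigma>).
        mem u \<sigma> a \<and> mem u \<sigma> b \<and> a < b \<and> mem u \<sigma> c \<and> mem u \<sigma> d \<and> c < d \<and> F a b = F c d \<longrightarrow> a = c \<and> b = d)"
    (is "?L \<longleftrightarrow> ?R") for u \<sigma>
  proof
    assume ?L
    then have *: "a = c \<and> b = d"
      if "mem u \<sigma> a" "mem u \<sigma> b" "a < b" "mem u \<sigma> c" "mem u \<sigma> d" "c < d" "f a b = f c d" for a b c d
      using that unfolding rainbow_iff Ball_def mem_iff by blast
    show ?R by (intro allI impI, rule *) (auto simp: F_eq)
  next
    assume R: ?R
    have "a = c \<and> b = d"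
      if *: "mem u \<sigma> a" "mem u \<sigma> b" "a < b" "mem u \<sigma> c" "mem u \<sigma> d" "c < d" "f a b = f c d" for a b c d
    proof -
      have "F a b = F c d" using * by (simp add: F_eq)
      with R[rule_format, OF mem[OF *(1)] mem[OF *(2)] mem[OF *(4)] mem[OF *(5)]] * show ?thesis by blast
    qed
    then show ?L unfolding rainbow_iff Ball_def mem_iff by blast
  qed
  moreover have "decidable A (\<lambda>z. \<forall>a<Suc (u z + \<sigma> z). \<forall>b<Suc (u z + \<sigma> z). \<forall>c<Suc (u z + \<sigma> z). \<forall>d<Suc (u z + \<sigma> z).
        mem (u z) (\<sigma> z) a \<and> mem (u z) (\<sigma> z) b \<and> a < b \<and> mem (u z) (\<sigma> z) c \<and> mem (u z) (\<sigma> z) d \<and> c < d \<and>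
        F a b = F c d \<longrightarrow> a = c \<and> b = d)"
    unfolding mem_def
    by (intro computability decidable_set_decode computable_compose2[OF F] assms(2,3)
        assms(2,3)[THEN computable_compose])
  ultimately show ?thesis by simp
qed

text \<open>What \<sigma> already tells about the join of \<open>Z\<close> with a set that
  end-extends it. Even queries go to \<open>Z\<close>; an odd query about \<open>i\<close> is
  answered only if \<open>2 ^ i \<le> \<sigma>\<close>, that is, if \<open>i\<close> is at most the
  largest element of \<sigma>.\<close>

definition queries :: "nat set \<Rightarrow> nat \<Rightarrow> nat \<Rightarrow> nat \<Rightarrow> bool" where
  "queries Z \<sigma> q b \<longleftrightarrow> (\<exists>i<Suc q. q = 2 * i \<and> b = (if i \<in> Z then 1 else 0)) \<or>
     (\<exists>i<q. q = Suc (2 * i) \<and> 2 ^ i \<le> \<sigma> \<and> b = (if i \<in> set_decode \<sigma> then 1 else 0))"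

definition halts :: "nat set \<Rightarrow> nat \<Rightarrow> nat \<Rightarrow> bool" where
  "halts Z e \<sigma> \<longleftrightarrow> (\<exists>p m. prog_num p = e \<and> computes (queries Z \<sigma>) p e m)"

text \<open>New elements lie above the region in which \<sigma> gives answers, so old answers
  persist.\<close>

lemma halts_mono:
  assumes "halts Z e \<sigma>" "end_ext \<sigma> \<tau>"
  shows "halts Z e \<tau>"
proof -
  have "queries Z \<tau> q b" if "queries Z \<sigma> q b" for q b
    using that assms(2) unfolding queries_def end_ext_iff by fastforce
  with assms(1) show ?thesis unfolding halts_def using computes_mono by blast
qed

text \<open>The segment itself serves as the oracle index of \<open>ce_halts\<close>.\<close>

lemma ce_halts_segment: "ce Z (\<lambda>z. halts Z (p2 z) (p1 z))"
  unfolding halts_def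
proof (rule ce_halts)
  show "decidable Z (\<lambda>z. queries Z (p1 z) (p1 (p2 z)) (p2 (p2 z)))"
    unfolding queries_def by (intro computability decidable_set_decode decidable_oracle)
qed

text \<open>A state codes a finite rainbow \<open>\<sigma>\<close>, a number \<open>t\<close> from which on every one-point extension of
  \<open>\<sigma>\<close> is a rainbow, the set \<open>\<beta>\<close> of indices that are forced to diverge, and the threshold \<open>k\<close> of the
  divergence requirement.\<close>

abbreviation "stem s \<equiv> p1 s"
abbreviation "lim s \<equiv> p1 (p2 s)"
abbreviation "neg s \<equiv> p1 (p2 (p2 s))"
abbreviation "thr s \<equiv> p2 (p2 (p2 s))"

section \<open>The construction of the rainbow from the jump of \<open>Z\<close>\<close>

locale low_rainbow =
  fixes Z :: "nat set" and f :: "nat \<Rightarrow> nat \<Rightarrow> nat"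
  assumes graph: "coloring_graph f \<le>\<^sub>T Z"
    and two_bounded: "two_bounded f" and stable: "rainbow_stable f"
begin

text \<open>The conjunct on rainbows allows \<open>big_avoid\<close> to be applied to
  \<open>bad\<close>: it makes every child in a big tree a rainbow, so that only partners can spoil
  extendibility.\<close>

definition bad :: "nat \<Rightarrow> nat \<Rightarrow> bool" where
  "bad \<beta> \<sigma> \<longleftrightarrow> rainbow f (set_decode \<sigma>) \<and> (\<exists>e\<in>set_decode \<beta>. halts Z e \<sigma>)"

text \<open>With the witness \<open>t\<close> supplied, extendibility becomes Pi_1 in
  \<open>Z\<close> and thus decidable from the jump.\<close>

definition stab :: "nat \<Rightarrow> nat \<Rightarrow> bool" where
  "stab \<sigma> t \<longleftrightarrow> (\<forall>u. t \<le> u \<longrightarrow> rainbow f (insert u (set_decode \<sigma>)))"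

text \<open>The threshold exceeds the current one by one unit, the room that
  \<open>big_avoid\<close> needs for the partners.\<close>

definition converges :: "nat \<Rightarrow> nat \<Rightarrow> bool" where
  "converges e s \<longleftrightarrow> big (bad (2 ^ e)) (Suc (thr s)) (stem s)"

definition state_inv :: "nat \<Rightarrow> nat \<Rightarrow> bool" where
  "state_inv e s \<longleftrightarrow> stab (stem s) (lim s) \<and> \<not> big (bad (neg s)) (thr s) (stem s) \<and> 0 < thr s \<and> neg s < 2 ^ e"

text \<open>The search result \<open>w\<close> proposes the new stem and its stability witness.
  After a negative answer the index \<open>e\<close> joins the forbidden ones, and the new threshold
  is the sum of the two for which bigness fails, as in \<open>big_union\<close>.\<close>

definition next_state :: "nat \<Rightarrow> nat \<Rightarrow> nat \<Rightarrow> nat" where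
  "next_state e s w = prod_encode (p1 w, prod_encode (p2 w,
     if converges e s then prod_encode (neg s, thr s)
     else prod_encode (2 ^ e + neg s, thr s + Suc (thr s))))"

definition step_ok :: "nat \<Rightarrow> nat \<Rightarrow> nat \<Rightarrow> bool" where
  "step_ok e s s' \<longleftrightarrow> state_inv (Suc e) s' \<and> stem s \<noteq> stem s' \<and> end_ext (stem s) (stem s') \<and>
     (converges e s \<longrightarrow> halts Z e (stem s'))"

text \<open>The start is the empty stem with nothing forbidden and threshold 1. The premise
  \<open>state_inv e s\<close> in the search makes it succeed for arbitrary \<open>e\<close> and
  \<open>s\<close>, as required for computability, although only states satisfying the invariant
  occur.\<close>

definition state :: "nat \<Rightarrow> nat" where
  "state = rec_nat (prod_encode (0, prod_encode (0, prod_encode (0, 1))))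
     (\<lambda>e s. next_state e s (LEAST w. state_inv e s \<longrightarrow> step_ok e s (next_state e s w)))"

lemma extendible_iff_stab: "extendible f (set_decode \<sigma>) \<longleftrightarrow> (\<exists>t. stab \<sigma> t)"
  by (simp add: extendible_def stab_def MOST_nat_le)

lemma stab_rainbow: "stab \<sigma> t \<Longrightarrow> rainbow f (set_decode \<sigma>)"
  using extendible_rainbow extendible_iff_stab by blast

lemma set_decode_power: "set_decode (2 ^ e) = {e}"
  using set_decode_snoc[of 0 e] by simp

lemma bad_insert: "\<beta> < 2 ^ e \<Longrightarrow> bad (2 ^ e + \<beta>) = (\<lambda>\<sigma>. bad \<beta> \<sigma> \<or> bad (2 ^ e) \<sigma>)"
  by (auto simp: bad_def set_decode_snoc set_decode_power fun_eq_iff)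

lemma step_exists:
  assumes "state_inv e s"
  shows "\<exists>w. step_ok e s (next_state e s w)"
proof -
  have s: "extendible f (set_decode (stem s))" "\<not> big (bad (neg s)) (thr s) (stem s)" "0 < thr s" "neg s < 2 ^ e"
    using assms by (auto simp: state_inv_def extendible_iff_stab)
  show ?thesis
  proof (cases "converges e s")
    case True
    have "\<exists>\<sigma>. end_ext (stem s) \<sigma> \<and> bad (2 ^ e) \<sigma> \<and> extendible f (set_decode \<sigma>) \<and> \<not> big (bad (neg s)) (thr s) \<sigma>"
      by (rule big_avoid[OF two_bounded stable _ True[unfolded converges_def] s(1,2)]) (simp add: bad_def)
    then obtain \<sigma> where \<sigma>: "end_ext (stem s) \<sigma>" "bad (2 ^ e) \<sigma>" "extendible f (set_decode \<sigma>)"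
        "\<not> big (bad (neg s)) (thr s) \<sigma>" by blast
    \<comment> \<open>The extension may be the old stem itself, when that is a leaf of the tree; one
      more element makes the stem grow strictly.\<close>
    then obtain u t where u: "\<sigma> < 2 ^ u" "stab (2 ^ u + \<sigma>) t" "\<not> big (bad (neg s)) (thr s) (2 ^ u + \<sigma>)"
      using not_big_snoc[OF two_bounded stable] extendible_iff_stab by blast
    have "halts Z e (2 ^ u + \<sigma>)"
      using \<sigma>(2) halts_mono[OF _ end_ext_snoc[OF u(1)]] by (auto simp: bad_def set_decode_power)
    moreover have "stem s < 2 ^ u + \<sigma>"
      using \<sigma>(1) u(1) unfolding end_ext_def by linarith
    moreover have "end_ext (stem s) (2 ^ u + \<sigma>)"
      using end_ext_trans[OF \<sigma>(1) end_ext_snoc[OF u(1)]] .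
    ultimately have "step_ok e s (next_state e s (prod_encode (2 ^ u + \<sigma>, t)))"
      using True s(3,4) u by (auto simp: step_ok_def next_state_def state_inv_def)
    then show ?thesis ..
  next
    case False
    \<comment> \<open>Were the enlarged requirement big, \<open>big_union\<close> would make big
      either the old one, against the invariant, or the one for \<open>e\<close>, against the
      negative answer.\<close>
    have "\<not> big (bad (2 ^ e + neg s)) (thr s + Suc (thr s)) (stem s)"
      using big_union s(2) False unfolding bad_insert[OF s(4)] converges_def by blast
    with s(1) obtain u t where u: "stem s < 2 ^ u" "stab (2 ^ u + stem s) t"
        "\<not> big (bad (2 ^ e + neg s)) (thr s + Suc (thr s)) (2 ^ u + stem s)"
      using not_big_snoc[OF two_bounded stable] extendible_iff_stab by blast
    have "step_ok e s (next_state e s (prod_encode (2 ^ u + stem s, t)))"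
      using False s(3,4) u end_ext_snoc[OF u(1)] by (auto simp: step_ok_def next_state_def state_inv_def)
    then show ?thesis ..
  qed
qed

lemma state_Suc: "\<exists>w. state (Suc e) = next_state e (state e) w \<and> (state_inv e (state e) \<longrightarrow> step_ok e (state e) (state (Suc e)))"
proof -
  define w where "w = (LEAST w. state_inv e (state e) \<longrightarrow> step_ok e (state e) (next_state e (state e) w))"
  have "state_inv e (state e) \<longrightarrow> step_ok e (state e) (next_state e (state e) w)"
    unfolding w_def by (rule LeastI_ex) (use step_exists in blast)
  moreover have "state (Suc e) = next_state e (state e) w"
    by (simp add: state_def w_def)
  ultimately show ?thesis by metis
qed

lemma state_inv: "state_inv e (state e)"
proof (induction e)
  case 0
  have "bad 0 = (\<lambda>_. False)" by (simp add: bad_def fun_eq_iff)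
  then show ?case
    using not_big_False[of 1 0]
    by (auto simp: state_inv_def state_def stab_def rainbow_def pairs_def inj_on_def)
next
  case (Suc e)
  then show ?case using state_Suc[of e] by (auto simp: step_ok_def)
qed

lemma step_ok: "step_ok e (state e) (state (Suc e))"
  using state_Suc[of e] state_inv[of e] by auto

definition R :: "nat set" where
  "R = (\<Union>e. set_decode (stem (state e)))"

lemma end_ext_state: "i \<le> j \<Longrightarrow> end_ext (stem (state i)) (stem (state j))"
proof (induction rule: dec_induct)
  case (step n)
  then show ?case using end_ext_trans step_ok[of n] by (auto simp: step_ok_def)
qed (rule end_ext_refl)

lemma strict_mono_state: "strict_mono (\<lambda>e. stem (state e))"
  unfolding strict_mono_Suc_iff
proof
  fix e
  show "stem (state e) < stem (state (Suc e))"
    using step_ok[of e] unfolding step_ok_def end_ext_def by linarith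
qed

text \<open>The stems have increasing codes and so are infinitely many different subsets of
  \<open>R\<close>.\<close>

lemma infinite_R: "infinite R"
proof
  assume "finite R"
  have "range (\<lambda>e. set_decode (stem (state e))) \<subseteq> Pow R" by (auto simp: R_def)
  with \<open>finite R\<close> have "finite (range (\<lambda>e. set_decode (stem (state e))))"
    using finite_subset by blast
  moreover have "inj (\<lambda>e. set_decode (stem (state e)))"
  proof (rule injI)
    fix i j assume "set_decode (stem (state i)) = set_decode (stem (state j))"
    then have "stem (state i) = stem (state j)" by (metis set_decode_inverse)
    then show "i = j" using strict_mono_eq[OF strict_mono_state] by blast
  qed
  ultimately show False using finite_imageD by blast
qed

lemma rainbow_R: "rainbow f R"
  unfolding rainbow_def
proof (rule inj_onI, clarify)
  fix a b c d
  assume "(a, b) \<in> pairs R" "(c, d) \<in> pairs R" and eq: "f a b = f c d"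
  then have R: "a \<in> R" "b \<in> R" "c \<in> R" "d \<in> R" "a < b" "c < d" by (auto simp: pairs_def)
  have "\<forall>\<^sub>\<infinity>n. x \<in> set_decode (stem (state n))" if "x \<in> R" for x
    using that end_ext_state unfolding R_def MOST_nat_le end_ext_iff by blast
  from this[OF R(1)] this[OF R(2)] this[OF R(3)] this[OF R(4)]
  have "\<forall>\<^sub>\<infinity>n. {a, b, c, d} \<subseteq> set_decode (stem (state n))"
    by eventually_elim simp
  then obtain n where "{a, b, c, d} \<subseteq> set_decode (stem (state n))"
    by (auto dest!: eventually_happens)
  then have "(a, b) \<in> pairs (set_decode (stem (state n)))" "(c, d) \<in> pairs (set_decode (stem (state n)))"
    using R(5,6) by (simp_all add: pairs_def)
  moreover have "rainbow f (set_decode (stem (state n)))"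
    using state_inv stab_rainbow unfolding state_inv_def by blast
  ultimately show "a = c \<and> b = d"
    using eq unfolding rainbow_def inj_on_def by fastforce
qed

text \<open>By end-extension, an element that enters after stage \<open>e\<close> satisfies
  \<open>stem (state e) < 2 ^ x\<close>; so the stem settles \<open>R\<close> up to its largest
  element.\<close>

lemma R_initial_segment:
  assumes "2 ^ x \<le> stem (state e)"
  shows "x \<in> R \<longleftrightarrow> x \<in> set_decode (stem (state e))"
proof
  assume "x \<in> R"
  then obtain j where j: "x \<in> set_decode (stem (state j))" by (auto simp: R_def)
  then show "x \<in> set_decode (stem (state e))"
    using end_ext_state[of e j] end_ext_state[of j e] assms unfolding end_ext_iff
    by (metis linorder_not_le nat_le_linear subsetD)
qed (auto simp: R_def)

lemma queries_sound:
  assumes "queries Z (stem (state e)) q b"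
  shows "answers (join Z R) q b"
  using assms R_initial_segment[of _ e] unfolding queries_def by (auto simp: join_iff)

lemma queries_complete:
  assumes "q < u" "answers (join Z R) q b" "2 ^ u \<le> stem (state e)"
  shows "queries Z (stem (state e)) q b"
proof (cases "even q")
  case True
  then obtain i where "q = 2 * i" by blast
  with assms(2) show ?thesis by (auto simp: queries_def join_iff)
next
  case False
  then obtain i where q: "q = Suc (2 * i)" by (metis oddE Suc_eq_plus1)
  have "(2::nat) ^ i \<le> 2 ^ u" using assms(1) q by (intro power_increasing) auto
  then have "2 ^ i \<le> stem (state e)" using assms(3) by linarith
  with assms(2) R_initial_segment[OF this] show ?thesis
    unfolding queries_def q by (auto simp: join_iff)
qed

lemma neg_state_mono: "i \<le> j \<Longrightarrow> set_decode (neg (state i)) \<subseteq> set_decode (neg (state j))"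
proof (induction rule: dec_induct)
  case (step n)
  have "neg (state n) < 2 ^ n" using state_inv[of n] by (simp add: state_inv_def)
  then show ?case
    using step state_Suc[of n] by (auto simp: next_state_def set_decode_snoc)
qed simp

text \<open>A positive answer is made true at the next stem. If the answer is negative but
  \<open>e\<close> halts, the use principle gives a later stem that already makes it halt; this stem
  is a leaf for the forbidden index \<open>e\<close>, hence big, against the invariant.\<close>

lemma jump_R_iff: "e \<in> jump (join Z R) \<longleftrightarrow> converges e (state e)"
proof
  assume "converges e (state e)"
  then have "halts Z e (stem (state (Suc e)))" using step_ok[of e] by (simp add: step_ok_def)
  then obtain p m where "prog_num p = e" "computes (queries Z (stem (state (Suc e)))) p e m"
    unfolding halts_def by blast
  moreover from this(2) have "eval (join Z R) p e = Some m"
    by (rule computes_sound) (rule queries_sound)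
  ultimately show "e \<in> jump (join Z R)" by (auto simp: jump_def)
next
  assume "e \<in> jump (join Z R)"
  then obtain p m where p: "prog_num p = e" "eval (join Z R) p e = Some m"
    by (auto simp: jump_def)
  then obtain u where u: "computes (\<lambda>q b. q < u \<and> answers (join Z R) q b) p e m"
    using computes_use by blast
  \<comment> \<open>\<open>Suc e\<close> puts stage \<open>j\<close> after the decision about
    \<open>e\<close>; \<open>2 ^ u\<close> makes the stem cover all queries of the computation,
    since stem codes are at least the stage number.\<close>
  define j where "j = Suc e + 2 ^ u"
  have "2 ^ u \<le> stem (state j)"
    using strict_mono_imp_increasing[OF strict_mono_state, of j] by (simp add: j_def)
  then have "computes (queries Z (stem (state j))) p e m"
    using queries_complete by (intro computes_mono[OF u]) blast
  then have halts: "halts Z e (stem (state j))" using p(1) by (auto simp: halts_def)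
  show "converges e (state e)"
  proof (rule ccontr)
    assume "\<not> converges e (state e)"
    moreover have "neg (state e) < 2 ^ e" using state_inv[of e] by (simp add: state_inv_def)
    ultimately have "e \<in> set_decode (neg (state (Suc e)))"
      using state_Suc[of e] by (auto simp: next_state_def set_decode_snoc)
    then have "e \<in> set_decode (neg (state j))"
      using neg_state_mono[of "Suc e" j] by (auto simp: j_def)
    moreover have "rainbow f (set_decode (stem (state j)))"
      using state_inv stab_rainbow unfolding state_inv_def by blast
    ultimately have "bad (neg (state j)) (stem (state j))" using halts by (auto simp: bad_def)
    then have "big (bad (neg (state j))) (thr (state j)) (stem (state j))" by (rule big.leaf)
    then show False using state_inv[of j] by (simp add: state_inv_def)
  qed
qed

lemma decidable_stab:
  assumes "computable (jump Z) \<sigma>" "computable (jump Z) t"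
  shows "decidable (jump Z) (\<lambda>x. stab (\<sigma> x) (t x))"
proof -
  have "decidable Z (\<lambda>z. p2 (p1 z) \<le> p2 z \<and> \<not> rainbow f (insert (p2 z) (set_decode (p1 (p1 z)))))"
    by (intro computability decidable_rainbow graph)
  then have "ce Z (\<lambda>z. \<exists>u. p2 z \<le> u \<and> \<not> rainbow f (insert u (set_decode (p1 z))))"
    by (intro ceI[of _ "\<lambda>z u. p2 z \<le> u \<and> \<not> rainbow f (insert u (set_decode (p1 z)))"]) simp_all
  from decidable_not[OF decidable_jump[OF this]]
  have "decidable (jump Z) (\<lambda>z. stab (p1 z) (p2 z))" by (simp add: stab_def)
  from decidable_compose2[OF this assms] show ?thesis .
qed

lemma decidable_halts:
  assumes "computable (jump Z) e" "computable (jump Z) \<sigma>"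
  shows "decidable (jump Z) (\<lambda>x. halts Z (e x) (\<sigma> x))"
  using decidable_compose2[OF decidable_jump[OF ce_halts_segment] assms(2,1)] .

lemma decidable_big:
  assumes "computable (jump Z) \<beta>" "computable (jump Z) k" "computable (jump Z) \<sigma>"
  shows "decidable (jump Z) (\<lambda>x. big (bad (\<beta> x)) (k x) (\<sigma> x))"
proof -
  \<comment> \<open>Reduces to one-point extensions, the form of \<open>decidable_rainbow\<close>: a
    nonempty set absorbs one of its own elements.\<close>
  have rainbow_set_decode: "rainbow f (set_decode \<sigma>) \<longleftrightarrow>
      \<sigma> = 0 \<or> (\<exists>x<\<sigma>. x \<in> set_decode \<sigma> \<and> rainbow f (insert x (set_decode \<sigma>)))" for \<sigma>
  proof (cases "\<sigma> = 0")
    case True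
    then show ?thesis by (simp add: rainbow_def pairs_def)
  next
    case False
    then have "set_decode \<sigma> \<noteq> {}" by (metis set_decode_inverse set_encode_empty)
    then obtain x where "x \<in> set_decode \<sigma>" by blast
    then show ?thesis using False set_decode_less[of x \<sigma>] by (auto simp: insert_absorb)
  qed
  have "ce Z (\<lambda>z. rainbow f (set_decode (p2 z)))"
    unfolding rainbow_set_decode
    by (intro ce_decidable computability decidable_rainbow graph decidable_set_decode)
  moreover have "ce Z (\<lambda>z. \<exists>e. e \<in> set_decode (p1 z) \<and> halts Z e (p2 z))"
  proof (rule ce_ex, rule ce_conj)
    show "ce Z (\<lambda>z. p2 z \<in> set_decode (p1 (p1 z)))"
      by (intro ce_decidable computability decidable_set_decode)
    have "computable Z (\<lambda>z. prod_encode (p2 (p1 z), p2 z))" by (intro computability)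
    from ce_compose[OF ce_halts_segment this] show "ce Z (\<lambda>z. halts Z (p2 z) (p2 (p1 z)))" by simp
  qed
  ultimately have "ce Z (\<lambda>z. bad (p1 z) (p2 z))"
    unfolding bad_def Bex_def by (rule ce_conj)
  from decidable_compose3[OF decidable_jump[OF ce_big[OF this]] assms] show ?thesis .
qed

lemma decidable_converges:
  assumes "computable (jump Z) e" "computable (jump Z) s"
  shows "decidable (jump Z) (\<lambda>x. converges (e x) (s x))"
  unfolding converges_def by (intro decidable_big computability assms)

lemma computable_next_state:
  assumes "computable (jump Z) e" "computable (jump Z) s" "computable (jump Z) w"
  shows "computable (jump Z) (\<lambda>x. next_state (e x) (s x) (w x))"
  unfolding next_state_def by (intro computability decidable_converges assms)

lemma decidable_state_inv:
  assumes "computable (jump Z) e" "computable (jump Z) s"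
  shows "decidable (jump Z) (\<lambda>x. state_inv (e x) (s x))"
  unfolding state_inv_def by (intro computability decidable_big decidable_stab assms)

lemma decidable_step_ok:
  assumes "computable (jump Z) e" "computable (jump Z) s" "computable (jump Z) s'"
  shows "decidable (jump Z) (\<lambda>x. step_ok (e x) (s x) (s' x))"
  unfolding step_ok_def end_ext_def
  by (intro computability decidable_state_inv decidable_converges decidable_halts decidable_set_decode assms
      assms[THEN computable_compose])

lemma computable_state: "computable (jump Z) state"
proof -
  have "\<exists>w. state_inv e s \<longrightarrow> step_ok e s (next_state e s w)" for e s
    using step_exists by blast
  then have "computable (jump Z) (\<lambda>x. LEAST w. state_inv (p1 (p2 x)) (p2 (p2 x)) \<longrightarrow>
      step_ok (p1 (p2 x)) (p2 (p2 x)) (next_state (p1 (p2 x)) (p2 (p2 x)) w))"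
    by (intro computable_Least computability decidable_step_ok decidable_state_inv computable_next_state)
  then have "computable (jump Z) (\<lambda>x. rec_nat (prod_encode (0, prod_encode (0, prod_encode (0, 1))))
     (\<lambda>e s. next_state e s (LEAST w. state_inv e s \<longrightarrow> step_ok e s (next_state e s w))) x)"
    by (intro computable_rec computability computable_next_state)
  then show ?thesis by (simp add: state_def)
qed

lemma jump_join_R: "jump (join Z R) \<le>\<^sub>T jump Z"
  unfolding turing_le_iff_decidable jump_R_iff
  by (intro decidable_converges computable_id computable_state)

end

section \<open>The chain of low sets and the model\<close>

lemma coloring_graph_rainbow_cong:
  assumes "coloring_graph f = coloring_graph g"
  shows "rainbow f R \<longleftrightarrow> rainbow g R"
proof -
  have "f x s = g x s" if "x < s" for x s
    using that coloring_graph_iff[of x s "f x s" f] coloring_graph_iff[of x s "f x s" g] assms by auto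
  then show ?thesis
    unfolding rainbow_def pairs_def by (intro inj_on_cong) auto
qed

lemma turing_le_join: "A \<le>\<^sub>T join A B" "B \<le>\<^sub>T join A B"
proof -
  have "decidable (join A B) (\<lambda>n. 2 * n \<in> join A B)" "decidable (join A B) (\<lambda>n. Suc (2 * n) \<in> join A B)"
    by (intro decidable_oracle computability)+
  then show "A \<le>\<^sub>T join A B" "B \<le>\<^sub>T join A B"
    by (simp_all add: turing_le_iff_decidable join_iff)
qed

lemma join_turing_le:
  assumes "A \<le>\<^sub>T C" "B \<le>\<^sub>T C"
  shows "join A B \<le>\<^sub>T C"
proof -
  note A = decidable_compose[OF assms(1)[unfolded turing_le_iff_decidable]]
    and B = decidable_compose[OF assms(2)[unfolded turing_le_iff_decidable]]
  have "n \<in> join A B \<longleftrightarrow> (\<exists>i<Suc n. n = 2 * i \<and> i \<in> A) \<or> (\<exists>i<Suc n. n = Suc (2 * i) \<and> i \<in> B)" for n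
    unfolding join_def by auto
  moreover have "decidable C (\<lambda>n. (\<exists>i<Suc n. n = 2 * i \<and> i \<in> A) \<or> (\<exists>i<Suc n. n = Suc (2 * i) \<and> i \<in> B))"
    by (intro computability A B)
  ultimately show ?thesis by (simp add: turing_le_iff_decidable)
qed

theorem low_rainbow_exists:
  assumes "low Z" "coloring_graph f \<le>\<^sub>T Z" "two_bounded f" "rainbow_stable f"
  shows "\<exists>R. infinite R \<and> rainbow f R \<and> low (join Z R)"
proof -
  interpret low_rainbow Z f using assms(2-4) by unfold_locales
  show ?thesis
    using infinite_R rainbow_R jump_join_R assms(1) turing_le_trans unfolding low_def by blast
qed

lemma low_empty: "low {}"
  by (simp add: low_def turing_le_refl)

theorem corollary5p22:
  "\<exists>M :: nat set set. turing_ideal M \<and> satisfies_SRRT22 M \<and> (\<forall>A \<in> M. low A)"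
proof -
  \<comment> \<open>Lists all candidates for colorings of the model by natural numbers. Programs
    that decide no set also contribute some \<open>G e\<close>, which matters only if it happens to
    be the graph of a suitable coloring.\<close>
  define G where "G e = {x. \<exists>p. prog_num p = e \<and> eval (jump {}) p x = Some 1}" for e
  \<comment> \<open>Stage \<open>n\<close> treats the candidate \<open>p1 n\<close>, provided its
    graph is computable from the current set. The component \<open>p2 n\<close> makes every
    candidate recur at arbitrarily late stages.\<close>
  define handles where "handles n X Y \<longleftrightarrow> X \<le>\<^sub>T Y \<and>
    (\<forall>f. coloring_graph f = G (p1 n) \<and> coloring_graph f \<le>\<^sub>T X \<and> two_bounded f \<and> rainbow_stable f \<longrightarrow>
      (\<exists>R. R \<le>\<^sub>T Y \<and> infinite R \<and> rainbow f R))" for n X Y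
  have "\<exists>Y. low Y \<and> handles n X Y" if X: "low X" for n X
  proof (cases "\<exists>f. coloring_graph f = G (p1 n) \<and> coloring_graph f \<le>\<^sub>T X \<and> two_bounded f \<and> rainbow_stable f")
    case True
    then obtain f where f: "coloring_graph f = G (p1 n)" "coloring_graph f \<le>\<^sub>T X" "two_bounded f" "rainbow_stable f"
      by blast
    then obtain R where R: "infinite R" "rainbow f R" "low (join X R)"
      using low_rainbow_exists[OF X] by blast
    \<comment> \<open>\<open>R\<close> was built for one \<open>f\<close>; any other function with
      the same graph has the same rainbows.\<close>
    have "handles n X (join X R)"
      unfolding handles_def using turing_le_join[of X R] turing_le_join[of R X] R f(1)
        coloring_graph_rainbow_cong by (metis turing_le_join(1,2))
    with R(3) show ?thesis by blast
  next
    case False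
    then show ?thesis using X turing_le_refl unfolding handles_def by blast
  qed
  then have "\<exists>Z. \<forall>n. low (Z n) \<and> handles n (Z n) (Z (Suc n))"
    using dependent_nat_choice[of "\<lambda>_ X. low X" handles] low_empty by blast
  then obtain Z where low_Z: "\<And>n. low (Z n)" and Z: "\<And>n. handles n (Z n) (Z (Suc n))" by blast
  have Z_mono: "Z i \<le>\<^sub>T Z j" if "i \<le> j" for i j
    using that
  proof (induction rule: dec_induct)
    case (step n)
    then show ?case using Z[of n] turing_le_trans unfolding handles_def by blast
  qed (rule turing_le_refl)
  define M where "M = {A. \<exists>n. A \<le>\<^sub>T Z n}"
  have low_M: "low A" if "A \<in> M" for A
    using that low_Z low_mono unfolding M_def by blast
  have "turing_ideal M"
    unfolding turing_ideal_def
  proof (intro conjI allI impI)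
    show "M \<noteq> {}" using turing_le_refl unfolding M_def by blast
  next
    fix A B assume "B \<in> M \<and> A \<le>\<^sub>T B"
    then show "A \<in> M" unfolding M_def using turing_le_trans by blast
  next
    fix A B assume "A \<in> M \<and> B \<in> M"
    then obtain i j where "A \<le>\<^sub>T Z i" "B \<le>\<^sub>T Z j" unfolding M_def by blast
    then have "A \<le>\<^sub>T Z (max i j)" "B \<le>\<^sub>T Z (max i j)"
      using turing_le_trans[OF _ Z_mono[of i "max i j"]] turing_le_trans[OF _ Z_mono[of j "max i j"]] by simp_all
    then show "join A B \<in> M" unfolding M_def using join_turing_le by blast
  qed
  moreover have "satisfies_SRRT22 M"
    unfolding satisfies_SRRT22_def
  proof (intro allI impI, elim conjE)
    fix f assume f: "coloring_graph f \<in> M" "two_bounded f" "rainbow_stable f"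
    then obtain i where i: "coloring_graph f \<le>\<^sub>T Z i" unfolding M_def by blast
    \<comment> \<open>A low set lies below its own jump, hence below the jump of the empty set, and
      so occurs in the list \<open>G\<close>.\<close>
    have "coloring_graph f \<le>\<^sub>T jump {}"
      using low_M[OF f(1)] turing_le_jump turing_le_trans unfolding low_def by blast
    then obtain p where "\<forall>n. eval (jump {}) p n = Some (if n \<in> coloring_graph f then 1 else 0)"
      unfolding turing_le_def by blast
    then have G: "coloring_graph f = G (prog_num p)"
      unfolding G_def by (auto dest!: inj_prog_num split: if_splits)
    \<comment> \<open>Pairing with \<open>i\<close> ensures \<open>i \<le> n\<close>, so the graph
      is already computable from \<open>Z n\<close> when stage \<open>n\<close> treats it.\<close>
    define n where "n = prod_encode (prog_num p, i)"
    have "i \<le> n" unfolding n_def by (rule le_prod_encode_2)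
    then have "coloring_graph f \<le>\<^sub>T Z n" using i Z_mono turing_le_trans by blast
    moreover have "coloring_graph f = G (p1 n)" by (simp add: n_def G)
    ultimately obtain R where "R \<le>\<^sub>T Z (Suc n)" "infinite R" "rainbow f R"
      using Z[of n] f(2,3) unfolding handles_def by blast
    then show "\<exists>R\<in>M. infinite R \<and> rainbow f R" unfolding M_def by blast
  qed
  ultimately show ?thesis using low_M by blast
qed

end
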